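(* Let $\mathbb{F}$ be an arbitrary field and let $(V,Y,\mathbf{1},\omega)$ be a vertex operator algebra over $\mathbb{F}$ equipped with a nondegenerate and Virasoro preserving bilinear form $(\cdot,\cdot)$. Given the linear operators $$c: V\to\mathbb{F},\quad v\mapsto (v,\mathbf{1}),\qquad\qquad \rho: V\to\mathbb{F},\quad v\mapsto (v,\omega),$$ and $$\Upsilon(x): V\to (V\otimes V)[[x,x^{-1}]],\qquad v\mapsto \Upsilon(x)v=\sum_{k\in\mathbb{Z}}\Delta_k(v)x^{-k-1},$$ defined by $$(\Upsilon(x)u,\, v\otimes w)=(u,\,Y(v,x)w)\qquad\text{for } u,v,w\in V,$$ the quadruple $(V,\Upsilon,c,\rho)$ is a vertex operator coalgebra.
   Context: Formal calculus. $\delta(x)=\sum_{n\in\mathbb{Z}}x^n$. For commuting formal variables $x_1,x_2$ and $n\in\mathbb{Z}$, $(x_1\pm x_2)^n$ is expanded in nonnegative integral powers of $x_2$ (the second variable); in particular $\delta\left(\frac{x_1-x_2}{x_0}\right)$ is a formal series in nonnegative integral powers of $x_2$. Vertex operator algebra (VOA) over $\mathbb{F}$ of rank $d\in\mathbb{F}$. A $\mathbb{Z}$-graded vector space $V=\coprod_{k\in\mathbb{Z}}V_{(k)}$ over $\mathbb{F}$ with $\dim V_{(k)}<\infty$ for all $k$ and $V_{(k)}=0$ for $k$ sufficiently small, together with a linear map $Y(\cdot,x):V\to(\mathrm{End}\,V)[[x,x^{-1}]]$, $Y(v,x)=\sum_{k\in\mathbb{Z}}v_kx^{-k-1}$, and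 two distinguished homogeneous vectors $\mathbf{1}$ (vacuum) and $\omega$ (Virasoro element) in $V$, satisfying: 1. Left unit: $Y(\mathbf{1},x)v=v$ for all $v\in V$. 2. Creation: $Y(v,x)\mathbf{1}\in V[[x]]$ and $\lim_{x\to0}Y(v,x)\mathbf{1}=v$ for all $v\in V$. 3. Truncation: given $v,w\in V$, $v_kw=0$ for $k$ sufficiently large. 4. Jacobi identity: for all $u,v\in V$, $$x_0^{-1}\delta\left(\tfrac{x_1-x_2}{x_0}\right)Y(u,x_1)Y(v,x_2)-x_0^{-1}\delta\left(\tfrac{x_2-x_1}{-x_0}\right)Y(v,x_2)Y(u,x_1)=x_2^{-1}\delta\left(\tfrac{x_1-x_0}{x_2}\right)Y(Y(u,x_0)v,x_2).$$ 5. Virasoro algebra: $[L(j),L(k)]=(j-k)L(j+k)+\frac{1}{12}(j^3-j)\delta_{j,-k}d$ for $j,k\in\mathbb{Z}$, where $Y(\omega,x)=\sum_{k\in\mathbb{Z}}L(k)x^{-k-2}$. 6. Grading: $L(0)v=kv$ for each $k\in\mathbb{Z}$ and $v\in V_{(k)}$. 7. $L(-1)$-derivative: $\frac{d}{dx}Y(v,x)=Y(L(-1)v,x)$ for all $v\in V$. Virasoro preserving form. A bilinear form $(\cdot,\cdot)$ on $V$ is Virasoro preserving if $(L(k)v_1,v_2)=(v_1,L(-k)v_2)$ for all $k\in\mathbb{Z}$ and $v_1,v_2\in V$. The form is extended to $V\otimes V$ by $(u_1\otimes u_2,v_1\otimes v_2)=(u_1,v_1)(u_2,v_2)$, and coefficientwise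 to formal series. Vertex operator coalgebra (VOC) over $\mathbb{F}$ of rank $d\in\mathbb{F}$. A $\mathbb{Z}$-graded vector space $V=\coprod_{k\in\mathbb{Z}}V_{(k)}$ over $\mathbb{F}$ with $\dim V_{(k)}<\infty$ for all $k$ and $V_{(k)}=0$ for $k$ sufficiently small, together with linear maps $\Upsilon(x):V\to(V\otimes V)[[x,x^{-1}]]$, $\Upsilon(x)v=\sum_{k\in\mathbb{Z}}\Delta_k(v)x^{-k-1}$ with $\Delta_k(v)\in V\otimes V$ (coproduct), $c:V\to\mathbb{F}$ (covacuum map) and $\rho:V\to\mathbb{F}$ (co-Virasoro map), satisfying (with $\mathbb{F}\otimes V$ and $V\otimes\mathbb{F}$ identified with $V$, and $T:V\otimes V\to V\otimes V$, $T(a\otimes b)=b\otimes a$): 1. Left counit: $(c\otimes \mathrm{Id}_V)\Upsilon(x)v=v$ for all $v\in V$. 2. Cocreation: $(\mathrm{Id}_V\otimes c)\Upsilon(x)v\in V[[x]]$ and $\lim_{x\to0}(\mathrm{Id}_V\otimes c)\Upsilon(x)v=v$ for all $v\in V$. 3. Truncation: given $v\in V$, $\Delta_k(v)=0$ for $k$ sufficiently small. 4. Jacobi identity: $$x_0^{-1}\delta\left(\tfrac{x_1-x_2}{x_0}\right)(\mathrm{Id}_V\otimes\Upsilon(x_2))\Upsilon(x_1)-x_0^{-1}\delta\left(\tfrac{x_2-x_1}{-x_0}\right)(T\otimes\mathrm{Id}_V)(\mathrm{Id}_V\otimes\Upsilon(x_1))\Upsilon(x_2)=x_2^{-1}\delta\left(\tfrac{x_1-x_0}{x_2}\right)(\Upsilon(x_0)\otimes\mathrm{Id}_V)\Upsilon(x_2).$$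 5. Virasoro algebra: $[L(j),L(k)]=(j-k)L(j+k)+\frac{1}{12}(j^3-j)\delta_{j,-k}d$ for $j,k\in\mathbb{Z}$, where the operators $L(k)$ are defined by $(\rho\otimes\mathrm{Id}_V)\Upsilon(x)=\sum_{k\in\mathbb{Z}}L(k)x^{k-2}$. 6. Grading: $L(0)v=kv$ for each $k\in\mathbb{Z}$ and $v\in V_{(k)}$, with $L(0)$ as in 5. 7. $L(1)$-derivative: $\frac{d}{dx}\Upsilon(x)=(L(1)\otimes\mathrm{Id}_V)\Upsilon(x)$, with $L(1)$ as in 5.
   Formalization: In positive characteristic, where the claim fails as stated, it is also assumed that v_k w has weight wt v + wt w − k − 1 for homogeneous v, w and that distinct graded pieces are orthogonal for the form; in characteristic 2 and 3 the undefined factor 1/12 is read as 0. *)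

theory Defs
  imports Complex_Main "HOL-Library.Function_Algebras" "HOL-Library.Groups_Big_Fun"
begin

section \<open>Multilinear maps and tensor powers of a vector space\<close>

text \<open>
  The tensor powers of the vector space V are realised without choosing a basis: an elementary
  tensor is the evaluation functional on bilinear (trilinear) forms, and the tensor power is the
  linear span of these evaluation functionals. The lemmas below establish its universal
  property for arbitrary target spaces, so this is the usual tensor product. The threefold power
  is unbracketed, so that the associativity isomorphism is suppressed.
\<close>

definition fun_scale :: "'a::field \<Rightarrow> ('x \<Rightarrow> 'a) \<Rightarrow> 'x \<Rightarrow> 'a" where
  "fun_scale r t = (\<lambda>B. r * t B)"

lemma vector_space_fun_scale: "vector_space fun_scale"
  by unfold_locales (auto simp: fun_scale_def fun_eq_iff algebra_simps)

lemma vector_space_mult: "vector_space ((*) :: 'a::field \<Rightarrow> 'a \<Rightarrow> 'a)"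
  by unfold_locales (auto simp: algebra_simps)

locale linear_space = vector_space scale
  for scale :: "'a::field \<Rightarrow> 'b::ab_group_add \<Rightarrow> 'b" (infixr \<open>*s\<close> 75)
begin

definition bilinear_map :: "('a \<Rightarrow> 'z::ab_group_add \<Rightarrow> 'z) \<Rightarrow> ('b \<Rightarrow> 'b \<Rightarrow> 'z) \<Rightarrow> bool" where
  "bilinear_map s f \<longleftrightarrow>
     (\<forall>v. Vector_Spaces.linear scale s (\<lambda>w. f v w)) \<and>
     (\<forall>w. Vector_Spaces.linear scale s (\<lambda>v. f v w))"

definition trilinear_map :: "('a \<Rightarrow> 'z::ab_group_add \<Rightarrow> 'z) \<Rightarrow> ('b \<Rightarrow> 'b \<Rightarrow> 'b \<Rightarrow> 'z) \<Rightarrow> bool" where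
  "trilinear_map s f \<longleftrightarrow>
     (\<forall>u v. Vector_Spaces.linear scale s (\<lambda>w. f u v w)) \<and>
     (\<forall>u w. Vector_Spaces.linear scale s (\<lambda>v. f u v w)) \<and>
     (\<forall>v w. Vector_Spaces.linear scale s (\<lambda>u. f u v w))"

definition tens :: "'b \<Rightarrow> 'b \<Rightarrow> ('b \<Rightarrow> 'b \<Rightarrow> 'a) \<Rightarrow> 'a" where
  "tens v w = (\<lambda>B. if bilinear_map (*) B then B v w else 0)"

definition tens3 :: "'b \<Rightarrow> 'b \<Rightarrow> 'b \<Rightarrow> ('b \<Rightarrow> 'b \<Rightarrow> 'b \<Rightarrow> 'a) \<Rightarrow> 'a" where
  "tens3 u v w = (\<lambda>B. if trilinear_map (*) B then B u v w else 0)"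

definition tensor2 :: "(('b \<Rightarrow> 'b \<Rightarrow> 'a) \<Rightarrow> 'a) set" where
  "tensor2 = module.span fun_scale (range (\<lambda>(v, w). tens v w))"

definition tensor3 :: "(('b \<Rightarrow> 'b \<Rightarrow> 'b \<Rightarrow> 'a) \<Rightarrow> 'a) set" where
  "tensor3 = module.span fun_scale (range (\<lambda>(u, v, w). tens3 u v w))"

text \<open>
  The linear map on the tensor power induced by a multilinear map f, sending a finite sum of
  elementary tensors to the corresponding sum of values of f. Meaningful only for multilinear f
  and on \<^term>\<open>tensor2\<close> (respectively \<^term>\<open>tensor3\<close>).
\<close>

definition lift2 :: "('b \<Rightarrow> 'b \<Rightarrow> 'z::ab_group_add) \<Rightarrow> (('b \<Rightarrow> 'b \<Rightarrow> 'a) \<Rightarrow> 'a) \<Rightarrow> 'z" where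
  "lift2 f t = (THE z. \<exists>xs. t = (\<Sum>(v, w)\<leftarrow>xs. tens v w) \<and> z = (\<Sum>(v, w)\<leftarrow>xs. f v w))"

definition lift3 :: "('b \<Rightarrow> 'b \<Rightarrow> 'b \<Rightarrow> 'z::ab_group_add) \<Rightarrow> (('b \<Rightarrow> 'b \<Rightarrow> 'b \<Rightarrow> 'a) \<Rightarrow> 'a) \<Rightarrow> 'z" where
  "lift3 f t = (THE z. \<exists>xs. t = (\<Sum>(u, v, w)\<leftarrow>xs. tens3 u v w) \<and> z = (\<Sum>(u, v, w)\<leftarrow>xs. f u v w))"

definition map_id_tensor :: "('b \<Rightarrow> (('b \<Rightarrow> 'b \<Rightarrow> 'a) \<Rightarrow> 'a)) \<Rightarrow>
    (('b \<Rightarrow> 'b \<Rightarrow> 'a) \<Rightarrow> 'a) \<Rightarrow> (('b \<Rightarrow> 'b \<Rightarrow> 'b \<Rightarrow> 'a) \<Rightarrow> 'a)" where \<comment> \<open>\<open>Id \<otimes> D\<close>\<close>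
  "map_id_tensor D = lift2 (\<lambda>a b. lift2 (\<lambda>p q. tens3 a p q) (D b))"

definition map_tensor_id :: "('b \<Rightarrow> (('b \<Rightarrow> 'b \<Rightarrow> 'a) \<Rightarrow> 'a)) \<Rightarrow>
    (('b \<Rightarrow> 'b \<Rightarrow> 'a) \<Rightarrow> 'a) \<Rightarrow> (('b \<Rightarrow> 'b \<Rightarrow> 'b \<Rightarrow> 'a) \<Rightarrow> 'a)" where \<comment> \<open>\<open>D \<otimes> Id\<close>\<close>
  "map_tensor_id D = lift2 (\<lambda>a b. lift2 (\<lambda>p q. tens3 p q b) (D a))"

definition swap_tensor_id :: "(('b \<Rightarrow> 'b \<Rightarrow> 'b \<Rightarrow> 'a) \<Rightarrow> 'a) \<Rightarrow> (('b \<Rightarrow> 'b \<Rightarrow> 'b \<Rightarrow> 'a) \<Rightarrow> 'a)" where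
  "swap_tensor_id = lift3 (\<lambda>a b c. tens3 b a c)" \<comment> \<open>\<open>T \<otimes> Id\<close>\<close>

definition functional_id :: "('b \<Rightarrow> 'a) \<Rightarrow> (('b \<Rightarrow> 'b \<Rightarrow> 'a) \<Rightarrow> 'a) \<Rightarrow> 'b" where
  "functional_id c = lift2 (\<lambda>a b. c a *s b)" \<comment> \<open>\<open>c \<otimes> Id\<close>, composed with \<open>F \<otimes> V \<cong> V\<close>\<close>

definition id_functional :: "('b \<Rightarrow> 'a) \<Rightarrow> (('b \<Rightarrow> 'b \<Rightarrow> 'a) \<Rightarrow> 'a) \<Rightarrow> 'b" where
  "id_functional c = lift2 (\<lambda>a b. c b *s a)" \<comment> \<open>\<open>Id \<otimes> c\<close>, composed with \<open>V \<otimes> F \<cong> V\<close>\<close>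

definition operator_id :: "('b \<Rightarrow> 'b) \<Rightarrow> (('b \<Rightarrow> 'b \<Rightarrow> 'a) \<Rightarrow> 'a) \<Rightarrow> (('b \<Rightarrow> 'b \<Rightarrow> 'a) \<Rightarrow> 'a)" where
  "operator_id f = lift2 (\<lambda>a b. tens (f a) b)" \<comment> \<open>\<open>f \<otimes> Id\<close>\<close>

definition tensor_form :: "('b \<Rightarrow> 'b \<Rightarrow> 'a) \<Rightarrow>
    (('b \<Rightarrow> 'b \<Rightarrow> 'a) \<Rightarrow> 'a) \<Rightarrow> (('b \<Rightarrow> 'b \<Rightarrow> 'a) \<Rightarrow> 'a) \<Rightarrow> 'a" where
  "tensor_form \<beta> s t = lift2 (\<lambda>u1 u2. lift2 (\<lambda>v1 v2. \<beta> u1 v1 * \<beta> u2 v2) t) s"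

lemma bilinear_mapD:
  assumes "bilinear_map s f"
  shows "f (a + a') b = f a b + f a' b" "f a (b + b') = f a b + f a b'"
    "f (r *s a) b = s r (f a b)" "f a (r *s b) = s r (f a b)"
proof -
  have l: "module_hom scale s (\<lambda>w. f a w)" "module_hom scale s (\<lambda>v. f v b)"
    using assms by (auto simp: bilinear_map_def module_hom_iff_linear)
  show "f (a + a') b = f a b + f a' b" "f a (b + b') = f a b + f a b'"
    "f (r *s a) b = s r (f a b)" "f a (r *s b) = s r (f a b)"
    using module_hom.add[OF l(1)] module_hom.add[OF l(2)]
      module_hom.scale[OF l(1)] module_hom.scale[OF l(2)] by auto
qed

lemma trilinear_mapD:
  assumes "trilinear_map s f"
  shows "f (a + a') b c = f a b c + f a' b c" "f a (b + b') c = f a b c + f a b' c"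
    "f a b (c + c') = f a b c + f a b c'"
    "f (r *s a) b c = s r (f a b c)" "f a (r *s b) c = s r (f a b c)" "f a b (r *s c) = s r (f a b c)"
proof -
  have l: "module_hom scale s (\<lambda>w. f a b w)" "module_hom scale s (\<lambda>v. f a v c)" "module_hom scale s (\<lambda>u. f u b c)"
    using assms by (auto simp: trilinear_map_def module_hom_iff_linear)
  show "f (a + a') b c = f a b c + f a' b c" "f a (b + b') c = f a b c + f a b' c"
    "f a b (c + c') = f a b c + f a b c'"
    "f (r *s a) b c = s r (f a b c)" "f a (r *s b) c = s r (f a b c)" "f a b (r *s c) = s r (f a b c)"
    using module_hom.add[OF l(1)] module_hom.add[OF l(2)] module_hom.add[OF l(3)]
      module_hom.scale[OF l(1)] module_hom.scale[OF l(2)] module_hom.scale[OF l(3)] by auto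
qed

lemma linearI:
  assumes "vector_space s" "\<And>x y. f (x + y) = f x + f y" "\<And>r x. f (r *s x) = s r (f x)"
  shows "Vector_Spaces.linear scale s f"
  using assms vector_space_axioms
  by (simp add: module_hom_iff_linear[symmetric] module_hom_def module_hom_axioms_def module_iff_vector_space)

lemma bilinear_map_tens: "bilinear_map fun_scale tens"
  unfolding bilinear_map_def
  by (auto intro!: linearI vector_space_fun_scale simp: tens_def fun_scale_def fun_eq_iff bilinear_mapD)

lemma trilinear_map_tens3: "trilinear_map fun_scale tens3"
  unfolding trilinear_map_def
  by (auto intro!: linearI vector_space_fun_scale simp: tens3_def fun_scale_def fun_eq_iff trilinear_mapD)

lemma tensor2_iff: "t \<in> tensor2 \<longleftrightarrow> (\<exists>xs. t = (\<Sum>(v, w)\<leftarrow>xs. tens v w))"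
proof
  interpret T: vector_space fun_scale by (rule vector_space_fun_scale)
  assume "t \<in> tensor2"
  then have "t \<in> T.span (range (\<lambda>(v, w). tens v w))" by (simp add: tensor2_def)
  then show "\<exists>xs. t = (\<Sum>(v, w)\<leftarrow>xs. tens v w)"
  proof (induction rule: T.span_induct_alt)
    case base
    show ?case by (rule exI[of _ "[]"]) (simp add: fun_eq_iff)
  next
    case (step r x y)
    then obtain v w xs where "x = tens v w" "y = (\<Sum>(v, w)\<leftarrow>xs. tens v w)" by auto
    then show ?case
      by (intro exI[of _ "(r *s v, w) # xs"]) (simp add: bilinear_mapD[OF bilinear_map_tens])
  qed
next
  interpret T: vector_space fun_scale by (rule vector_space_fun_scale)
  assume "\<exists>xs. t = (\<Sum>(v, w)\<leftarrow>xs. tens v w)"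
  then obtain xs where t: "t = (\<Sum>(v, w)\<leftarrow>xs. tens v w)" by auto
  show "t \<in> tensor2" unfolding t tensor2_def
  proof (induction xs)
    case Nil
    show ?case by (simp only: list.map sum_list.Nil T.span_zero)
  next
    case (Cons x xs)
    have "(case x of (v, w) \<Rightarrow> tens v w) \<in> range (\<lambda>(v, w). tens v w)" by auto
    from T.span_add[OF T.span_base[OF this] Cons] show ?case by (simp only: list.map sum_list.Cons)
  qed
qed

lemma tensor3_iff: "t \<in> tensor3 \<longleftrightarrow> (\<exists>xs. t = (\<Sum>(u, v, w)\<leftarrow>xs. tens3 u v w))"
proof
  interpret T: vector_space fun_scale by (rule vector_space_fun_scale)
  assume "t \<in> tensor3"
  then have "t \<in> T.span (range (\<lambda>(u, v, w). tens3 u v w))" by (simp add: tensor3_def)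
  then show "\<exists>xs. t = (\<Sum>(u, v, w)\<leftarrow>xs. tens3 u v w)"
  proof (induction rule: T.span_induct_alt)
    case base
    show ?case by (rule exI[of _ "[]"]) (simp add: fun_eq_iff)
  next
    case (step r x y)
    then obtain u v w xs where "x = tens3 u v w" "y = (\<Sum>(u, v, w)\<leftarrow>xs. tens3 u v w)" by auto
    then show ?case
      by (intro exI[of _ "(r *s u, v, w) # xs"]) (simp add: trilinear_mapD[OF trilinear_map_tens3])
  qed
next
  interpret T: vector_space fun_scale by (rule vector_space_fun_scale)
  assume "\<exists>xs. t = (\<Sum>(u, v, w)\<leftarrow>xs. tens3 u v w)"
  then obtain xs where t: "t = (\<Sum>(u, v, w)\<leftarrow>xs. tens3 u v w)" by auto
  show "t \<in> tensor3" unfolding t tensor3_def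
  proof (induction xs)
    case Nil
    show ?case by (simp only: list.map sum_list.Nil T.span_zero)
  next
    case (Cons x xs)
    have "(case x of (u, v, w) \<Rightarrow> tens3 u v w) \<in> range (\<lambda>(u, v, w). tens3 u v w)" by auto
    from T.span_add[OF T.span_base[OF this] Cons] show ?case by (simp only: list.map sum_list.Cons)
  qed
qed

lemma functionals_separate:
  assumes s: "vector_space s" and eq: "\<And>\<phi>. Vector_Spaces.linear s (*) \<phi> \<Longrightarrow> \<phi> x = \<phi> y"
  shows "x = y"
proof (rule ccontr)
  assume "x \<noteq> y"
  interpret S: vector_space s by fact
  interpret P: vector_space_pair s "(*)"
    using s vector_space_mult by (simp add: vector_space_pair_def)
  have "S.independent {x - y}" using \<open>x \<noteq> y\<close> by simp
  from P.linear_independent_extend[OF this, of "\<lambda>_. 1"]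
  obtain \<phi> where \<phi>: "Vector_Spaces.linear s (*) \<phi>" "\<phi> (x - y) = 1" by auto
  have "\<phi> (x - y) = \<phi> x - \<phi> y"
    using \<phi>(1) by (simp add: module_hom_iff_linear[symmetric] module_hom.diff)
  with eq[OF \<phi>(1)] \<phi>(2) show False by simp
qed

lemma linear_sum_list:
  assumes "Vector_Spaces.linear s s' \<phi>"
  shows "\<phi> (\<Sum>x\<leftarrow>xs. f x) = (\<Sum>x\<leftarrow>xs. \<phi> (f x))"
proof -
  have "module_hom s s' \<phi>" using assms by (simp add: module_hom_iff_linear)
  then show ?thesis
    by (induction xs) (auto simp: module_hom.add module_hom.zero)
qed

lemma sum_list_apply:
  fixes f :: "'i \<Rightarrow> 'y \<Rightarrow> 'z::ab_group_add"
  shows "(\<Sum>x\<leftarrow>xs. f x) B = (\<Sum>x\<leftarrow>xs. f x B)"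
  by (induction xs) auto

lemma lift2_sum:
  assumes f: "bilinear_map s f"
  shows "lift2 f (\<Sum>(v, w)\<leftarrow>xs. tens v w) = (\<Sum>(v, w)\<leftarrow>xs. f v w)"
  unfolding lift2_def
proof (rule the_equality)
  show "\<exists>ys. (\<Sum>(v, w)\<leftarrow>xs. tens v w) = (\<Sum>(v, w)\<leftarrow>ys. tens v w) \<and>
      (\<Sum>(v, w)\<leftarrow>xs. f v w) = (\<Sum>(v, w)\<leftarrow>ys. f v w)" by blast
next
  fix z assume "\<exists>ys. (\<Sum>(v, w)\<leftarrow>xs. tens v w) = (\<Sum>(v, w)\<leftarrow>ys. tens v w) \<and> z = (\<Sum>(v, w)\<leftarrow>ys. f v w)"
  then obtain ys where eq: "(\<Sum>(v, w)\<leftarrow>xs. tens v w) = (\<Sum>(v, w)\<leftarrow>ys. tens v w)"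
    and z: "z = (\<Sum>(v, w)\<leftarrow>ys. f v w)" by blast
  have s: "vector_space s"
    using f by (auto simp: bilinear_map_def Vector_Spaces.linear_def)
  show "z = (\<Sum>(v, w)\<leftarrow>xs. f v w)"
  proof (rule functionals_separate[OF s])
    fix \<phi> :: "'c \<Rightarrow> 'a" assume \<phi>: "Vector_Spaces.linear s (*) \<phi>"
    have h: "module_hom s (*) \<phi>" using \<phi> by (simp add: module_hom_iff_linear)
    have B: "bilinear_map (*) (\<lambda>v w. \<phi> (f v w))"
      unfolding bilinear_map_def
      by (auto intro!: linearI vector_space_mult
          simp: bilinear_mapD[OF f] module_hom.add[OF h] module_hom.scale[OF h])
    have key: "\<phi> (\<Sum>(v, w)\<leftarrow>zs. f v w) = (\<Sum>(v, w)\<leftarrow>zs. tens v w) (\<lambda>v w. \<phi> (f v w))" for zs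
      by (simp add: linear_sum_list[OF \<phi>] sum_list_apply split_def tens_def B)
    show "\<phi> z = \<phi> (\<Sum>(v, w)\<leftarrow>xs. f v w)" by (simp add: z key eq)
  qed
qed

lemma lift3_sum:
  assumes f: "trilinear_map s f"
  shows "lift3 f (\<Sum>(u, v, w)\<leftarrow>xs. tens3 u v w) = (\<Sum>(u, v, w)\<leftarrow>xs. f u v w)"
  unfolding lift3_def
proof (rule the_equality)
  show "\<exists>ys. (\<Sum>(u, v, w)\<leftarrow>xs. tens3 u v w) = (\<Sum>(u, v, w)\<leftarrow>ys. tens3 u v w) \<and>
      (\<Sum>(u, v, w)\<leftarrow>xs. f u v w) = (\<Sum>(u, v, w)\<leftarrow>ys. f u v w)" by blast
next
  fix z assume "\<exists>ys. (\<Sum>(u, v, w)\<leftarrow>xs. tens3 u v w) = (\<Sum>(u, v, w)\<leftarrow>ys. tens3 u v w) \<and>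
    z = (\<Sum>(u, v, w)\<leftarrow>ys. f u v w)"
  then obtain ys where eq: "(\<Sum>(u, v, w)\<leftarrow>xs. tens3 u v w) = (\<Sum>(u, v, w)\<leftarrow>ys. tens3 u v w)"
    and z: "z = (\<Sum>(u, v, w)\<leftarrow>ys. f u v w)" by blast
  have s: "vector_space s"
    using f by (auto simp: trilinear_map_def Vector_Spaces.linear_def)
  show "z = (\<Sum>(u, v, w)\<leftarrow>xs. f u v w)"
  proof (rule functionals_separate[OF s])
    fix \<phi> :: "'c \<Rightarrow> 'a" assume \<phi>: "Vector_Spaces.linear s (*) \<phi>"
    have h: "module_hom s (*) \<phi>" using \<phi> by (simp add: module_hom_iff_linear)
    have B: "trilinear_map (*) (\<lambda>u v w. \<phi> (f u v w))"
      unfolding trilinear_map_def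
      by (auto intro!: linearI vector_space_mult
          simp: trilinear_mapD[OF f] module_hom.add[OF h] module_hom.scale[OF h])
    have key: "\<phi> (\<Sum>(u, v, w)\<leftarrow>zs. f u v w) = (\<Sum>(u, v, w)\<leftarrow>zs. tens3 u v w) (\<lambda>u v w. \<phi> (f u v w))" for zs
      by (simp add: linear_sum_list[OF \<phi>] sum_list_apply split_def tens3_def B)
    show "\<phi> z = \<phi> (\<Sum>(u, v, w)\<leftarrow>xs. f u v w)" by (simp add: z key eq)
  qed
qed

theorem lift2_universal:
  assumes f: "bilinear_map s f"
  shows "lift2 f (tens v w) = f v w"
    and "t \<in> tensor2 \<Longrightarrow> t' \<in> tensor2 \<Longrightarrow> lift2 f (t + t') = lift2 f t + lift2 f t'"
    and "t \<in> tensor2 \<Longrightarrow> lift2 f (fun_scale r t) = s r (lift2 f t)"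
proof -
  show "lift2 f (tens v w) = f v w" using lift2_sum[OF f, of "[(v, w)]"] by simp
  show "lift2 f (t + t') = lift2 f t + lift2 f t'" if T: "t \<in> tensor2" "t' \<in> tensor2"
  proof -
    obtain xs ys where e: "t = (\<Sum>(v, w)\<leftarrow>xs. tens v w)" "t' = (\<Sum>(v, w)\<leftarrow>ys. tens v w)"
      using T unfolding tensor2_iff by blast
    have "t + t' = (\<Sum>(v, w)\<leftarrow>xs @ ys. tens v w)" by (simp add: e)
    then show ?thesis by (simp only: lift2_sum[OF f]) (simp add: e lift2_sum[OF f])
  qed
  show "lift2 f (fun_scale r t) = s r (lift2 f t)" if T: "t \<in> tensor2"
  proof -
    obtain xs where e: "t = (\<Sum>(v, w)\<leftarrow>xs. tens v w)"
      using T unfolding tensor2_iff by blast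
    have sc: "Vector_Spaces.linear s s (s r)"
    proof -
      have "module s"
        using f by (auto simp: bilinear_map_def Vector_Spaces.linear_def module_iff_vector_space)
      then show ?thesis
        by (simp add: module_hom_iff_linear[symmetric] module.module_hom_scale_self)
    qed
    have "fun_scale r t = (\<Sum>(v, w)\<leftarrow>map (\<lambda>(v, w). (r *s v, w)) xs. tens v w)"
      unfolding e by (induction xs)
        (auto simp: bilinear_mapD[OF bilinear_map_tens] fun_eq_iff fun_scale_def algebra_simps)
    then have "lift2 f (fun_scale r t) = (\<Sum>(v, w)\<leftarrow>map (\<lambda>(v, w). (r *s v, w)) xs. f v w)"
      by (simp only: lift2_sum[OF f])
    also have "\<dots> = s r (\<Sum>(v, w)\<leftarrow>xs. f v w)"
      by (simp add: linear_sum_list[OF sc] split_def o_def bilinear_mapD[OF f])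
    finally show ?thesis by (simp add: e lift2_sum[OF f])
  qed
qed

theorem lift3_universal:
  assumes f: "trilinear_map s f"
  shows "lift3 f (tens3 u v w) = f u v w"
    and "t \<in> tensor3 \<Longrightarrow> t' \<in> tensor3 \<Longrightarrow> lift3 f (t + t') = lift3 f t + lift3 f t'"
    and "t \<in> tensor3 \<Longrightarrow> lift3 f (fun_scale r t) = s r (lift3 f t)"
proof -
  show "lift3 f (tens3 u v w) = f u v w" using lift3_sum[OF f, of "[(u, v, w)]"] by simp
  show "lift3 f (t + t') = lift3 f t + lift3 f t'" if T: "t \<in> tensor3" "t' \<in> tensor3"
  proof -
    obtain xs ys where e: "t = (\<Sum>(u, v, w)\<leftarrow>xs. tens3 u v w)" "t' = (\<Sum>(u, v, w)\<leftarrow>ys. tens3 u v w)"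
      using T unfolding tensor3_iff by blast
    have "t + t' = (\<Sum>(u, v, w)\<leftarrow>xs @ ys. tens3 u v w)" by (simp add: e)
    then show ?thesis by (simp only: lift3_sum[OF f]) (simp add: e lift3_sum[OF f])
  qed
  show "lift3 f (fun_scale r t) = s r (lift3 f t)" if T: "t \<in> tensor3"
  proof -
    obtain xs where e: "t = (\<Sum>(u, v, w)\<leftarrow>xs. tens3 u v w)"
      using T unfolding tensor3_iff by blast
    have sc: "Vector_Spaces.linear s s (s r)"
    proof -
      have "module s"
        using f by (auto simp: trilinear_map_def Vector_Spaces.linear_def module_iff_vector_space)
      then show ?thesis
        by (simp add: module_hom_iff_linear[symmetric] module.module_hom_scale_self)
    qed
    have "fun_scale r t = (\<Sum>(u, v, w)\<leftarrow>map (\<lambda>(u, v, w). (r *s u, v, w)) xs. tens3 u v w)"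
      unfolding e by (induction xs)
        (auto simp: trilinear_mapD[OF trilinear_map_tens3] fun_eq_iff fun_scale_def algebra_simps)
    then have "lift3 f (fun_scale r t) = (\<Sum>(u, v, w)\<leftarrow>map (\<lambda>(u, v, w). (r *s u, v, w)) xs. f u v w)"
      by (simp only: lift3_sum[OF f])
    also have "\<dots> = s r (\<Sum>(u, v, w)\<leftarrow>xs. f u v w)"
      by (simp add: linear_sum_list[OF sc] split_def o_def trilinear_mapD[OF f])
    finally show ?thesis by (simp add: e lift3_sum[OF f])
  qed
qed

end


section \<open>Formal calculus\<close>

text \<open>
  A formal series in one variable is the function \<^typ>\<open>int \<Rightarrow> 'w\<close> of its coefficients, the value at n
  being the coefficient of the n-th power of the variable; a series in \<open>x0, x1, x2\<close> is a function
  of the three exponents in this order. In particular the modes are \<open>v\<^sub>k = Y v (- k - 1)\<close> for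
  \<open>Y(v,x) = \<Sum>\<^sub>n (Y v n) x\<^sup>n\<close>, and similarly for coproducts.
\<close>

definition int_choose :: "int \<Rightarrow> nat \<Rightarrow> int" where
  \<comment> \<open>the integer instance of \<open>gchoose\<close>, whose sort constraint in \<open>Complex_Main\<close> rules out
      writing it at type int; the division is exact\<close>
  "int_choose n k = (\<Prod>i = 0..<k. n - of_nat i) div fact k"

lemmas int_choose_eq_gbinomial = gbinomial_prod_rev[where 'a = int, folded int_choose_def, symmetric]

definition diff_power :: "int \<Rightarrow> int \<Rightarrow> int \<Rightarrow> 'a::field" where
  \<comment> \<open>the coefficient of \<open>x\<^sup>i y\<^sup>j\<close> in \<open>(x - y)\<^sup>n\<close>, expanded in nonnegative powers of \<open>y\<close>;
      the binomial coefficient is an integer, so this makes sense in every characteristic\<close>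
  "diff_power n i j = (if 0 \<le> j \<and> i + j = n then of_int ((- 1) ^ nat j * int_choose n (nat j)) else 0)"

definition delta_quotient :: "'a::field \<Rightarrow> int \<Rightarrow> int \<Rightarrow> int \<Rightarrow> 'a" where
  \<comment> \<open>for \<open>\<epsilon> = \<plusminus>1\<close>, the coefficient of \<open>z\<^sup>p x\<^sup>i y\<^sup>j\<close> in
      \<open>z\<^sup>-\<^sup>1 \<delta>((x - y)/(\<epsilon> z)) = \<Sum>\<^sub>n \<epsilon>\<^sup>-\<^sup>n z\<^sup>-\<^sup>n\<^sup>-\<^sup>1 (x - y)\<^sup>n\<close>; only \<open>n = - p - 1\<close> contributes\<close>
  "delta_quotient \<epsilon> p i j = (\<epsilon> powi (p + 1)) * diff_power (- p - 1) i j"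

definition series_mult :: "('a::field \<Rightarrow> 'w::ab_group_add \<Rightarrow> 'w) \<Rightarrow>
    (int \<Rightarrow> int \<Rightarrow> int \<Rightarrow> 'a) \<Rightarrow> (int \<Rightarrow> int \<Rightarrow> int \<Rightarrow> 'w) \<Rightarrow> int \<Rightarrow> int \<Rightarrow> int \<Rightarrow> 'w" where
  \<comment> \<open>Cauchy product; in every use below, the truncation axiom leaves finitely many nonzero summands\<close>
  "series_mult s K A a b c = Sum_any (\<lambda>(i, j, k). s (K i j k) (A (a - i) (b - j) (c - k)))"


section \<open>Vertex operator algebras and coalgebras\<close>

locale graded_vector_space = linear_space scale
  for scale :: "'a::field \<Rightarrow> 'v::ab_group_add \<Rightarrow> 'v" (infixr \<open>*s\<close> 75) +
  fixes G :: "int \<Rightarrow> 'v set"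
  assumes subspace_G: "subspace (G k)"
    and direct_sum: "\<exists>!f. (\<forall>k. f k \<in> G k) \<and> finite {k. f k \<noteq> 0} \<and> v = Sum_any f"
    and finite_dim: "\<exists>B. finite B \<and> span B = G k"
    and bounded_below: "\<exists>N. \<forall>k<N. G k = {0}"

definition virasoro_mode :: "('v \<Rightarrow> int \<Rightarrow> 'v \<Rightarrow> 'v) \<Rightarrow> 'v \<Rightarrow> int \<Rightarrow> 'v \<Rightarrow> 'v" where
  \<comment> \<open>\<open>Y(\<omega>,x) = \<Sum>\<^sub>k L(k) x\<^sup>-\<^sup>k\<^sup>-\<^sup>2\<close>\<close>
  "virasoro_mode Y \<omega> k = Y \<omega> (- k - 2)"

definition (in linear_space) covirasoro_mode ::
    "(int \<Rightarrow> 'b \<Rightarrow> (('b \<Rightarrow> 'b \<Rightarrow> 'a) \<Rightarrow> 'a)) \<Rightarrow> ('b \<Rightarrow> 'a) \<Rightarrow> int \<Rightarrow> 'b \<Rightarrow> 'b" where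
  \<comment> \<open>\<open>(\<rho> \<otimes> Id) \<Upsilon>(x) = \<Sum>\<^sub>k L(k) x\<^sup>k\<^sup>-\<^sup>2\<close>\<close>
  "covirasoro_mode Ups \<rho> k v = functional_id \<rho> (Ups (k - 2) v)"

definition (in linear_space) virasoro_relations :: "(int \<Rightarrow> 'b \<Rightarrow> 'b) \<Rightarrow> 'a \<Rightarrow> bool" where
  \<comment> \<open>in characteristic 2 and 3, division by 12 follows the convention \<open>x / 0 = 0\<close>\<close>
  "virasoro_relations L d \<longleftrightarrow> (\<forall>j k v. L j (L k v) - L k (L j v) =
     of_int (j - k) *s L (j + k) v + (if j = - k then (1 / 12 * of_int (j ^ 3 - j) * d) *s v else 0))"

locale vertex_operator_algebra = graded_vector_space scale G
  for scale :: "'a::field \<Rightarrow> 'v::ab_group_add \<Rightarrow> 'v" (infixr \<open>*s\<close> 75)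
    and G :: "int \<Rightarrow> 'v set" +
  fixes Y :: "'v \<Rightarrow> int \<Rightarrow> 'v \<Rightarrow> 'v" and vac \<omega> :: 'v and d :: 'a
  assumes Y_bilinear: "bilinear_map scale (\<lambda>v w. Y v n w)"
    and vac_homogeneous: "\<exists>k. vac \<in> G k"
    and omega_homogeneous: "\<exists>k. \<omega> \<in> G k"
    and left_unit: "Y vac n v = (if n = 0 then v else 0)"
    and creation_regular: "n < 0 \<Longrightarrow> Y v n vac = 0"
    and creation_limit: "Y v 0 vac = v"
    and truncation: "\<exists>N. \<forall>k>N. Y v (- k - 1) w = 0"
    and jacobi:
      "series_mult scale (\<lambda>a b c. delta_quotient 1 a b c)
         (\<lambda>a b c. if a = 0 then Y u b (Y v c w) else 0) a b c
       - series_mult scale (\<lambda>a b c. delta_quotient (- 1) a c b)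
         (\<lambda>a b c. if a = 0 then Y v c (Y u b w) else 0) a b c
       = series_mult scale (\<lambda>a b c. delta_quotient 1 c b a)
         (\<lambda>a b c. if b = 0 then Y (Y u a v) c w else 0) a b c"
    and virasoro: "virasoro_relations (virasoro_mode Y \<omega>) d"
    and grading: "v \<in> G k \<Longrightarrow> virasoro_mode Y \<omega> 0 v = of_int k *s v"
    and derivative: "of_int (n + 1) *s Y v (n + 1) w = Y (virasoro_mode Y \<omega> (- 1) v) n w"

locale vertex_operator_coalgebra = graded_vector_space scale G
  for scale :: "'a::field \<Rightarrow> 'v::ab_group_add \<Rightarrow> 'v" (infixr \<open>*s\<close> 75)
    and G :: "int \<Rightarrow> 'v set" +
  fixes Ups :: "int \<Rightarrow> 'v \<Rightarrow> (('v \<Rightarrow> 'v \<Rightarrow> 'a) \<Rightarrow> 'a)" and c \<rho> :: "'v \<Rightarrow> 'a" and d :: 'a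
  assumes Ups_in_tensor: "Ups n v \<in> tensor2"
    and Ups_linear: "Vector_Spaces.linear scale fun_scale (Ups n)"
    and c_linear: "Vector_Spaces.linear scale (*) c"
    and rho_linear: "Vector_Spaces.linear scale (*) \<rho>"
    and left_counit: "functional_id c (Ups n v) = (if n = 0 then v else 0)"
    and cocreation_regular: "n < 0 \<Longrightarrow> id_functional c (Ups n v) = 0"
    and cocreation_limit: "id_functional c (Ups 0 v) = v"
    and truncation: "\<exists>N. \<forall>k<N. Ups (- k - 1) v = 0"
    and jacobi:
      "series_mult fun_scale (\<lambda>a b c. delta_quotient 1 a b c)
         (\<lambda>a b c. if a = 0 then map_id_tensor (Ups c) (Ups b v) else 0) a0 a1 a2
       - series_mult fun_scale (\<lambda>a b c. delta_quotient (- 1) a c b)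
         (\<lambda>a b c. if a = 0 then swap_tensor_id (map_id_tensor (Ups b) (Ups c v)) else 0) a0 a1 a2
       = series_mult fun_scale (\<lambda>a b c. delta_quotient 1 c b a)
         (\<lambda>a b c. if b = 0 then map_tensor_id (Ups a) (Ups c v) else 0) a0 a1 a2"
    and virasoro: "virasoro_relations (covirasoro_mode Ups \<rho>) d"
    and grading: "v \<in> G k \<Longrightarrow> covirasoro_mode Ups \<rho> 0 v = of_int k *s v"
    and derivative: "fun_scale (of_int (n + 1)) (Ups (n + 1) v)
       = operator_id (covirasoro_mode Ups \<rho> 1) (Ups n v)"


section \<open>Bilinear forms on a vertex operator algebra\<close>

definition nondegenerate :: "('v::zero \<Rightarrow> 'v \<Rightarrow> 'a::zero) \<Rightarrow> bool" where
  "nondegenerate \<beta> \<longleftrightarrow> (\<forall>u. (\<forall>v. \<beta> u v = 0) \<longrightarrow> u = 0) \<and> (\<forall>v. (\<forall>u. \<beta> u v = 0) \<longrightarrow> v = 0)"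

definition virasoro_preserving ::
    "('v \<Rightarrow> int \<Rightarrow> 'v \<Rightarrow> 'v) \<Rightarrow> 'v \<Rightarrow> ('v \<Rightarrow> 'v \<Rightarrow> 'a) \<Rightarrow> bool" where
  "virasoro_preserving Y \<omega> \<beta> \<longleftrightarrow>
     (\<forall>k u v. \<beta> (virasoro_mode Y \<omega> k u) v = \<beta> u (virasoro_mode Y \<omega> (- k) v))"

text \<open>
  In characteristic 0 the following is a consequence of the axioms: \<open>L(0)\<close> has the distinct
  eigenvalues k on the \<open>V\<^sub>(\<^sub>k\<^sub>)\<close>. In characteristic p, \<open>L(0)\<close> sees weights only modulo p,
  and the coproduct need not exist or be truncated without it. Example: p = 5, \<open>V = F[t]\<close>
  with \<open>t\<^sup>n\<close> of weight 5n, \<open>Y(f,x)g = f(t + x\<^sup>5) g(t)\<close>, vacuum 1, \<open>\<omega> = 0\<close>, d = 0,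
  is a vertex operator algebra, and the form with orthonormal basis \<open>t\<^sup>n\<close> is nondegenerate and
  Virasoro preserving; but \<open>\<Delta>\<^sub>k(u) \<noteq> 0\<close> for all \<open>u \<noteq> 0\<close> and all \<open>k = - 5m - 1\<close>, \<open>m \<ge> 0\<close>.
\<close>

definition weight_compatible ::
    "(int \<Rightarrow> 'v set) \<Rightarrow> ('v \<Rightarrow> int \<Rightarrow> 'v \<Rightarrow> 'v) \<Rightarrow> ('v \<Rightarrow> 'v \<Rightarrow> 'a::zero) \<Rightarrow> bool" where
  "weight_compatible G Y \<beta> \<longleftrightarrow>
     (\<forall>a b k. \<forall>v\<in>G a. \<forall>w\<in>G b. Y v (- k - 1) w \<in> G (a + b - k - 1)) \<and>
     (\<forall>a b. a \<noteq> b \<longrightarrow> (\<forall>v\<in>G a. \<forall>w\<in>G b. \<beta> v w = 0))"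

definition (in linear_space) adjoint_coproduct ::
    "('b \<Rightarrow> 'b \<Rightarrow> 'a) \<Rightarrow> ('b \<Rightarrow> int \<Rightarrow> 'b \<Rightarrow> 'b) \<Rightarrow> (int \<Rightarrow> 'b \<Rightarrow> (('b \<Rightarrow> 'b \<Rightarrow> 'a) \<Rightarrow> 'a)) \<Rightarrow> bool" where
  \<comment> \<open>\<open>(\<Upsilon>(x) u, v \<otimes> w) = (u, Y(v,x) w)\<close>\<close>
  "adjoint_coproduct \<beta> Y Ups \<longleftrightarrow> (\<forall>n u. Ups n u \<in> tensor2) \<and>
     (\<forall>n u v w. tensor_form \<beta> (Ups n u) (tens v w) = \<beta> u (Y v n w))"

end

theory Submission
  imports Defs
begin

text \<open>
  Every axiom of a vertex operator coalgebra is the transpose of an axiom of a vertex operator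
  algebra. An equation between vectors, or between tensors in the second or third tensor power,
  can be tested by pairing with vectors, respectively with elementary tensors, because the form is
  nondegenerate and remains so on tensor powers (\<open>tensor2_eqI\<close>, \<open>tensor3_eqI\<close>). Under this
  pairing \<open>\<Upsilon>(x)\<close> becomes \<open>Y(\<cdot>, x)\<close>: the iterated coproducts \<open>(Id \<otimes> \<Upsilon>) \<Upsilon>\<close> and
  \<open>(\<Upsilon> \<otimes> Id) \<Upsilon>\<close> pair to products and iterates of vertex operators, so the Jacobi identity
  transposes to the Jacobi identity; contraction with the vacuum turns the unit and creation
  axioms into the counit and cocreation axioms; and contraction with \<open>\<omega>\<close> gives the adjoint of
  \<open>L(- k)\<close>, which is \<open>L(k)\<close> since the form is Virasoro preserving.

  Two points are not formal. First, the adjoint \<open>\<Upsilon>(x) u\<close> must exist in the algebraic tensor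
  square, coefficient by coefficient, and its coefficients must vanish for large exponents. Both
  follow from weights: distinct weight spaces are orthogonal and modes shift weights, so with the
  lower bound on the grading the bilinear form \<open>(v, w) \<mapsto> (u, Y(v, x) w)\<close> lives, for each power
  of \<open>x\<close>, on finitely many pairs of weight spaces, and on none for high powers
  (\<open>matrix_coefficient_support\<close>). These spaces are finite-dimensional, and expansion along dual
  bases represents the form by a tensor (\<open>bilinear_form_representable\<close>). In characteristic zero the
  facts about weights come from the operator \<open>L(0)\<close>: it is self-adjoint, its commutator with a vertex
  operator is read off from the Jacobi identity, and the weight spaces are exactly its eigenspaces
  (\<open>weight_compatible_char_0\<close>). In positive characteristic they are part of the hypotheses.

  Second, the products with delta functions in the Jacobi identities are infinite sums made finite by
  truncation, which has opposite directions in an algebra and in a coalgebra; both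
  sides are nevertheless finite (\<open>finite_delta_supports\<close>), so that pairing may be carried out term by term.
\<close>

section \<open>Multilinear functionals and tensors\<close>

context linear_space
begin

lemma bilinear_mapI:
  assumes "vector_space s"
    and "\<And>a a' b. f (a + a') b = f a b + f a' b" "\<And>a b b'. f a (b + b') = f a b + f a b'"
    and "\<And>r a b. f (r *s a) b = s r (f a b)" "\<And>r a b. f a (r *s b) = s r (f a b)"
  shows "bilinear_map s f"
  unfolding bilinear_map_def using assms by (auto intro!: linearI)

lemma trilinear_mapI:
  assumes "vector_space s"
    and "\<And>a a' b c. f (a + a') b c = f a b c + f a' b c"
    and "\<And>a b b' c. f a (b + b') c = f a b c + f a b' c"
    and "\<And>a b c c'. f a b (c + c') = f a b c + f a b c'"
    and "\<And>r a b c. f (r *s a) b c = s r (f a b c)"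
    and "\<And>r a b c. f a (r *s b) c = s r (f a b c)"
    and "\<And>r a b c. f a b (r *s c) = s r (f a b c)"
  shows "trilinear_map s f"
  unfolding trilinear_map_def using assms by (auto intro!: linearI)

lemma linearD:
  assumes "Vector_Spaces.linear s s' f"
  shows "f (x + y) = f x + f y" "f (s r x) = s' r (f x)" "f 0 = 0" "f (x - y) = f x - f y"
proof -
  have "module_hom s s' f" using assms by (simp add: module_hom_iff_linear)
  then show "f (x + y) = f x + f y" "f (s r x) = s' r (f x)" "f 0 = 0" "f (x - y) = f x - f y"
    by (auto simp: module_hom.add module_hom.scale module_hom.zero module_hom.diff)
qed

lemma subspace_tensor2: "module.subspace fun_scale tensor2"
  and subspace_tensor3: "module.subspace fun_scale tensor3"
proof -
  interpret T: vector_space "fun_scale :: 'a \<Rightarrow> (('b \<Rightarrow> 'b \<Rightarrow> 'a) \<Rightarrow> 'a) \<Rightarrow> _"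
    by (rule vector_space_fun_scale)
  show "T.subspace tensor2" unfolding tensor2_def by (rule T.subspace_span)
  interpret T3: vector_space "fun_scale :: 'a \<Rightarrow> (('b \<Rightarrow> 'b \<Rightarrow> 'b \<Rightarrow> 'a) \<Rightarrow> 'a) \<Rightarrow> _"
    by (rule vector_space_fun_scale)
  show "T3.subspace tensor3" unfolding tensor3_def by (rule T3.subspace_span)
qed

lemma tens3_in_tensor3: "tens3 a b c \<in> tensor3"
  unfolding tensor3_iff by (rule exI[of _ "[(a, b, c)]"]) simp

lemma tens_in_tensor2: "tens a b \<in> tensor2"
  unfolding tensor2_iff by (rule exI[of _ "[(a, b)]"]) simp

lemma tensor2_apply:
  assumes "bilinear_map (*) B"
  shows "(\<Sum>(a, b)\<leftarrow>xs. tens a b) B = (\<Sum>(a, b)\<leftarrow>xs. B a b)"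
  using assms by (simp add: sum_list_apply split_def tens_def)

lemma tensor3_apply:
  assumes "trilinear_map (*) B"
  shows "(\<Sum>(a, b, c)\<leftarrow>xs. tens3 a b c) B = (\<Sum>(a, b, c)\<leftarrow>xs. B a b c)"
  using assms by (simp add: sum_list_apply split_def tens3_def)

lemma bilinear_map_compose:
  assumes "bilinear_map s f" "Vector_Spaces.linear s s' \<phi>"
  shows "bilinear_map s' (\<lambda>a b. \<phi> (f a b))"
  by (rule bilinear_mapI)
    (use assms(2) in \<open>auto simp: Vector_Spaces.linear_def bilinear_mapD[OF assms(1)] linearD[OF assms(2)]\<close>)

lemma trilinear_map_compose:
  assumes "trilinear_map s f" "Vector_Spaces.linear s s' \<phi>"
  shows "trilinear_map s' (\<lambda>a b c. \<phi> (f a b c))"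
  by (rule trilinear_mapI)
    (use assms(2) in \<open>auto simp: Vector_Spaces.linear_def trilinear_mapD[OF assms(1)] linearD[OF assms(2)]\<close>)

text \<open>
  A tensor is a functional on bilinear forms, so a linear functional of an induced map is again a
  value of the tensor. This lemma and its trilinear analogue
  turn each of the structure maps \<open>Id \<otimes> D\<close>, \<open>D \<otimes> Id\<close>, \<open>T \<otimes> Id\<close>, \<open>c \<otimes> Id\<close> into an evaluation.
\<close>
lemma functional_lift2:
  assumes f: "bilinear_map s f" and \<phi>: "Vector_Spaces.linear s (*) \<phi>" and t: "t \<in> tensor2"
  shows "\<phi> (lift2 f t) = t (\<lambda>a b. \<phi> (f a b))"
proof -
  obtain xs where t: "t = (\<Sum>(v, w)\<leftarrow>xs. tens v w)" using t unfolding tensor2_iff by blast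
  show ?thesis
    unfolding t lift2_sum[OF f] tensor2_apply[OF bilinear_map_compose[OF f \<phi>]]
    by (simp add: linear_sum_list[OF \<phi>] split_def)
qed

lemma functional_lift3:
  assumes f: "trilinear_map s f" and \<phi>: "Vector_Spaces.linear s (*) \<phi>" and t: "t \<in> tensor3"
  shows "\<phi> (lift3 f t) = t (\<lambda>a b c. \<phi> (f a b c))"
proof -
  obtain xs where t: "t = (\<Sum>(u, v, w)\<leftarrow>xs. tens3 u v w)" using t unfolding tensor3_iff by blast
  show ?thesis
    unfolding t lift3_sum[OF f] tensor3_apply[OF trilinear_map_compose[OF f \<phi>]]
    by (simp add: linear_sum_list[OF \<phi>] split_def)
qed

lemma linear_id_mult: "Vector_Spaces.linear (*) (*) (\<lambda>x::'a. x)"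
proof -
  interpret S: vector_space "(*) :: 'a \<Rightarrow> 'a \<Rightarrow> 'a" by (rule vector_space_mult)
  show ?thesis by (rule S.linear_ident)
qed

lemma lift2_scalar:
  assumes "bilinear_map (*) B" "t \<in> tensor2"
  shows "lift2 B t = t B"
  using functional_lift2[OF assms(1) linear_id_mult assms(2)] by simp

lemma linear_eval: "Vector_Spaces.linear fun_scale (*) (\<lambda>t. t B)"
proof -
  interpret T: vector_space "fun_scale" by (rule vector_space_fun_scale)
  interpret S: vector_space "(*) :: 'a \<Rightarrow> 'a \<Rightarrow> 'a" by (rule vector_space_mult)
  show ?thesis by unfold_locales (auto simp: fun_scale_def algebra_simps)
qed

text \<open>
  By its type a tensor could depend on \<open>B\<close> in any way, but elements of the tensor square are linear
  on bilinear \<open>B\<close>; homogeneity is needed to pull a factor out of the inner coproduct in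
  \<open>Id \<otimes> \<Upsilon>\<close> and \<open>\<Upsilon> \<otimes> Id\<close>.
\<close>
lemma tensor2_scale_arg:
  assumes "t \<in> tensor2" "bilinear_map (*) B"
  shows "t (\<lambda>a b. r * B a b) = r * t B"
proof -
  obtain xs where t: "t = (\<Sum>(v, w)\<leftarrow>xs. tens v w)" using assms(1) unfolding tensor2_iff by blast
  have B: "bilinear_map (*) (\<lambda>a b. r * B a b)"
    by (rule bilinear_mapI[OF vector_space_mult]) (auto simp: bilinear_mapD[OF assms(2)] algebra_simps)
  show ?thesis unfolding t tensor2_apply[OF assms(2)] tensor2_apply[OF B]
    by (simp add: split_def sum_list_const_mult)
qed

lemma lift2_mem:
  assumes f: "bilinear_map s f" and t: "t \<in> tensor2"
    and S: "module.subspace s S" and mem: "\<And>a b. f a b \<in> S"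
  shows "lift2 f t \<in> S"
proof -
  interpret S: vector_space s using f by (auto simp: bilinear_map_def Vector_Spaces.linear_def)
  obtain xs where t: "t = (\<Sum>(v, w)\<leftarrow>xs. tens v w)" using t unfolding tensor2_iff by blast
  have "(\<Sum>(v, w)\<leftarrow>xs. f v w) \<in> S"
    by (induction xs) (auto simp: S S.subspace_0 intro!: S.subspace_add[OF S] mem)
  then show ?thesis unfolding t lift2_sum[OF f] .
qed

lemma lift3_mem:
  assumes f: "trilinear_map s f" and t: "t \<in> tensor3"
    and S: "module.subspace s S" and mem: "\<And>a b c. f a b c \<in> S"
  shows "lift3 f t \<in> S"
proof -
  interpret S: vector_space s using f by (auto simp: trilinear_map_def Vector_Spaces.linear_def)
  obtain xs where t: "t = (\<Sum>(u, v, w)\<leftarrow>xs. tens3 u v w)" using t unfolding tensor3_iff by blast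
  have "(\<Sum>(u, v, w)\<leftarrow>xs. f u v w) \<in> S"
    by (induction xs) (auto simp: S S.subspace_0 intro!: S.subspace_add[OF S] mem)
  then show ?thesis unfolding t lift3_sum[OF f] .
qed

lemma bilinear_map_tens3:
  "bilinear_map fun_scale (\<lambda>p q. tens3 a p q)" "bilinear_map fun_scale (\<lambda>p q. tens3 p q a)"
  by (rule bilinear_mapI[OF vector_space_fun_scale]; simp add: trilinear_mapD[OF trilinear_map_tens3])+

lemma bilinear_map_lift2_tens3:
  assumes D: "Vector_Spaces.linear scale fun_scale D" "\<And>b. D b \<in> tensor2"
  shows "bilinear_map fun_scale (\<lambda>a b. lift2 (\<lambda>p q. tens3 a p q) (D b))" (is "bilinear_map _ ?f")
    and "bilinear_map fun_scale (\<lambda>a b. lift2 (\<lambda>p q. tens3 p q b) (D a))" (is "bilinear_map _ ?g")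
proof -
  note l = linearD[OF D(1)] lift2_universal(2,3)[OF bilinear_map_tens3(1)]
    lift2_universal(2,3)[OF bilinear_map_tens3(2)] D(2)
  have lin: "lift2 (\<lambda>p q. tens3 (a + a') p q) t = lift2 (\<lambda>p q. tens3 a p q) t + lift2 (\<lambda>p q. tens3 a' p q) t"
    "lift2 (\<lambda>p q. tens3 p q (a + a')) t = lift2 (\<lambda>p q. tens3 p q a) t + lift2 (\<lambda>p q. tens3 p q a') t"
    "lift2 (\<lambda>p q. tens3 (r *s a) p q) t = fun_scale r (lift2 (\<lambda>p q. tens3 a p q) t)"
    "lift2 (\<lambda>p q. tens3 p q (r *s a)) t = fun_scale r (lift2 (\<lambda>p q. tens3 p q a) t)"
    if t2: "t \<in> tensor2" for a a' r t
  proof -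
    obtain xs where t: "t = (\<Sum>(v, w)\<leftarrow>xs. tens v w)" using t2 unfolding tensor2_iff by blast
    show "lift2 (\<lambda>p q. tens3 (a + a') p q) t = lift2 (\<lambda>p q. tens3 a p q) t + lift2 (\<lambda>p q. tens3 a' p q) t"
      "lift2 (\<lambda>p q. tens3 p q (a + a')) t = lift2 (\<lambda>p q. tens3 p q a) t + lift2 (\<lambda>p q. tens3 p q a') t"
      unfolding t lift2_sum[OF bilinear_map_tens3(1)] lift2_sum[OF bilinear_map_tens3(2)]
      by (auto simp: split_def sum_list_addf trilinear_mapD[OF trilinear_map_tens3])
    show "lift2 (\<lambda>p q. tens3 (r *s a) p q) t = fun_scale r (lift2 (\<lambda>p q. tens3 a p q) t)"
      "lift2 (\<lambda>p q. tens3 p q (r *s a)) t = fun_scale r (lift2 (\<lambda>p q. tens3 p q a) t)"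
      unfolding t lift2_sum[OF bilinear_map_tens3(1)] lift2_sum[OF bilinear_map_tens3(2)]
      by (auto simp: split_def fun_eq_iff fun_scale_def sum_list_apply sum_list_const_mult
          trilinear_mapD[OF trilinear_map_tens3])
  qed
  show "bilinear_map fun_scale ?f" "bilinear_map fun_scale ?g"
    by (rule bilinear_mapI[OF vector_space_fun_scale]; simp add: l lin)+
qed

lemma map_id_tensor_apply:
  assumes D: "Vector_Spaces.linear scale fun_scale D" "\<And>b. D b \<in> tensor2"
    and t: "t \<in> tensor2" and T: "trilinear_map (*) T"
  shows "map_id_tensor D t T = t (\<lambda>a b. D b (\<lambda>p q. T a p q))"
  unfolding map_id_tensor_def functional_lift2[OF bilinear_map_lift2_tens3(1)[OF D] linear_eval t]
    functional_lift2[OF bilinear_map_tens3(1) linear_eval D(2)]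
  by (simp add: tens3_def T)

lemma map_tensor_id_apply:
  assumes D: "Vector_Spaces.linear scale fun_scale D" "\<And>b. D b \<in> tensor2"
    and t: "t \<in> tensor2" and T: "trilinear_map (*) T"
  shows "map_tensor_id D t T = t (\<lambda>a b. D a (\<lambda>p q. T p q b))"
  unfolding map_tensor_id_def functional_lift2[OF bilinear_map_lift2_tens3(2)[OF D] linear_eval t]
    functional_lift2[OF bilinear_map_tens3(2) linear_eval D(2)]
  by (simp add: tens3_def T)

lemma map_id_tensor_mem:
  assumes D: "Vector_Spaces.linear scale fun_scale D" "\<And>b. D b \<in> tensor2" and t: "t \<in> tensor2"
  shows "map_id_tensor D t \<in> tensor3"
  unfolding map_id_tensor_def
  by (intro lift2_mem[OF _ _ subspace_tensor3] bilinear_map_lift2_tens3 bilinear_map_tens3 assms tens3_in_tensor3)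

lemma map_tensor_id_mem:
  assumes D: "Vector_Spaces.linear scale fun_scale D" "\<And>b. D b \<in> tensor2" and t: "t \<in> tensor2"
  shows "map_tensor_id D t \<in> tensor3"
  unfolding map_tensor_id_def
  by (intro lift2_mem[OF _ _ subspace_tensor3] bilinear_map_lift2_tens3 bilinear_map_tens3 assms tens3_in_tensor3)

lemma trilinear_map_swap:
  assumes "trilinear_map s f"
  shows "trilinear_map s (\<lambda>a b c. f b a c)"
  using assms unfolding trilinear_map_def by auto

lemma swap_tensor_id_apply:
  assumes t: "t \<in> tensor3" and T: "trilinear_map (*) T"
  shows "swap_tensor_id t T = t (\<lambda>a b c. T b a c)"
  unfolding swap_tensor_id_def functional_lift3[OF trilinear_map_swap[OF trilinear_map_tens3] linear_eval t]
  by (simp add: tens3_def T)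

lemma swap_tensor_id_mem: "t \<in> tensor3 \<Longrightarrow> swap_tensor_id t \<in> tensor3"
  unfolding swap_tensor_id_def
  by (rule lift3_mem[OF trilinear_map_swap[OF trilinear_map_tens3] _ subspace_tensor3 tens3_in_tensor3])

lemma bilinear_map_tens_left:
  assumes "Vector_Spaces.linear scale scale f"
  shows "bilinear_map fun_scale (\<lambda>a b. tens (f a) b)"
  by (rule bilinear_mapI[OF vector_space_fun_scale])
    (simp_all add: linearD[OF assms] bilinear_mapD[OF bilinear_map_tens])

lemma operator_id_apply:
  assumes f: "Vector_Spaces.linear scale scale f" and t: "t \<in> tensor2" and B: "bilinear_map (*) B"
  shows "operator_id f t B = t (\<lambda>a b. B (f a) b)"
  unfolding operator_id_def functional_lift2[OF bilinear_map_tens_left[OF f] linear_eval t]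
  by (simp add: tens_def B)

lemma operator_id_mem:
  assumes "Vector_Spaces.linear scale scale f" "t \<in> tensor2"
  shows "operator_id f t \<in> tensor2"
  unfolding operator_id_def
  by (rule lift2_mem[OF bilinear_map_tens_left[OF assms(1)] assms(2) subspace_tensor2 tens_in_tensor2])

end


section \<open>Dual families and separation of tensors\<close>

context linear_space
begin

lemma linear_sum:
  assumes "Vector_Spaces.linear s s' f"
  shows "f (\<Sum>i\<in>A. g i) = (\<Sum>i\<in>A. f (g i))"
  by (induction A rule: infinite_finite_induct) (auto simp: linearD[OF assms])

lemma bilinear_map_linear:
  assumes "bilinear_map s f"
  shows "Vector_Spaces.linear scale s (f a)" "Vector_Spaces.linear scale s (\<lambda>a. f a b)"
  using assms unfolding bilinear_map_def by auto

lemma bilinear_map_zero: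
  assumes "bilinear_map s f"
  shows "f 0 b = 0" "f a 0 = 0"
  using linearD(3)[OF bilinear_map_linear(1)[OF assms]] linearD(3)[OF bilinear_map_linear(2)[OF assms]] by auto

lemma bilinear_map_sum:
  assumes "bilinear_map s f"
  shows "f (\<Sum>i\<in>A. g i) b = (\<Sum>i\<in>A. f (g i) b)" "f a (\<Sum>i\<in>A. g i) = (\<Sum>i\<in>A. f a (g i))"
  using linear_sum[OF bilinear_map_linear(1)[OF assms]] linear_sum[OF bilinear_map_linear(2)[OF assms]] by auto

lemma bilinear_map_diff:
  assumes "bilinear_map s f"
  shows "f (a - a') b = f a b - f a' b" "f a (b - b') = f a b - f a b'"
  using linearD(4)[OF bilinear_map_linear(1)[OF assms]] linearD(4)[OF bilinear_map_linear(2)[OF assms]] by auto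

lemma bilinear_map_flip: "bilinear_map s f \<Longrightarrow> bilinear_map s (\<lambda>a b. f b a)"
  unfolding bilinear_map_def by auto

text \<open>
  If the new vector \<open>e\<close> could not be detected by elements of \<open>S\<close> orthogonal to the old family,
  then, by linear algebra against the dual family already found, \<open>e\<close> minus its
  projection to the span of the old family would be orthogonal to all of \<open>S\<close>, hence zero,
  contradicting independence.
\<close>
lemma dual_family:
  assumes \<gamma>: "bilinear_map (*) \<gamma>" and S: "subspace S" and B: "finite B" "independent B"
    and sep: "\<And>v. v \<in> span B \<Longrightarrow> (\<forall>x\<in>S. \<gamma> x v = 0) \<Longrightarrow> v = 0"
  shows "\<exists>d. (\<forall>e\<in>B. d e \<in> S) \<and> (\<forall>e\<in>B. \<forall>f\<in>B. \<gamma> (d e) f = (if e = f then 1 else 0))"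
  using B sep
proof (induction B rule: finite_induct)
  case empty
  then show ?case by auto
next
  case (insert e B)
  have ind: "independent B" using insert.prems(1) by (rule independent_mono) auto
  have "span B \<subseteq> span (insert e B)" by (rule span_mono) auto
  then obtain d where dS: "\<forall>e\<in>B. d e \<in> S" and d: "\<forall>e\<in>B. \<forall>f\<in>B. \<gamma> (d e) f = (if e = f then 1 else 0)"
    using insert.IH[OF ind] insert.prems(2) by blast
  note \<gamma>_simps = bilinear_mapD[OF \<gamma>] bilinear_map_diff[OF \<gamma>] bilinear_map_sum[OF \<gamma>]
  define v where "v = e - (\<Sum>f\<in>B. \<gamma> (d f) e *s f)"
  have sp: "(\<Sum>f\<in>B. \<gamma> (d f) e *s f) \<in> span B"
    by (intro span_sum span_scale span_base)
  have "e \<notin> span B" using insert.prems(1) insert.hyps(2) by (simp add: dependent_insertD independent_insert)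
  then have v0: "v \<noteq> 0" using sp unfolding v_def by auto
  have "v \<in> span (insert e B)" unfolding v_def
    using sp \<open>span B \<subseteq> span (insert e B)\<close> by (intro span_diff[OF span_base]) auto
  then obtain x0 where x0: "x0 \<in> S" "\<gamma> x0 v \<noteq> 0"
    using insert.prems(2) v0 by blast
  define x where "x = x0 - (\<Sum>f\<in>B. \<gamma> x0 f *s d f)"
  have xS: "x \<in> S" unfolding x_def
    by (intro subspace_diff[OF S] x0 subspace_sum[OF S] subspace_scale[OF S]) (use dS in auto)
  have xB: "\<gamma> x f = 0" if "f \<in> B" for f
  proof -
    have "(\<Sum>i\<in>B. \<gamma> x0 i * \<gamma> (d i) f) = (\<Sum>i\<in>B. if i = f then \<gamma> x0 i else 0)"
      by (rule sum.cong) (use d that in auto)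
    then show ?thesis using that insert.hyps(1) by (simp add: x_def \<gamma>_simps)
  qed
  \<comment> \<open>projecting \<open>x0\<close> off the dual family and \<open>e\<close> off the old family are adjoint operations\<close>
  have xe: "\<gamma> x e \<noteq> 0"
    using x0(2) by (simp add: x_def v_def \<gamma>_simps mult.commute)
  define y where "y = (1 / \<gamma> x e) *s x"
  have y: "y \<in> S" "\<gamma> y e = 1" "\<And>f. f \<in> B \<Longrightarrow> \<gamma> y f = 0"
    using xS xe xB by (auto simp: y_def \<gamma>_simps subspace_scale[OF S])
  let ?d = "\<lambda>f. if f = e then y else d f - \<gamma> (d f) e *s y"
  have "\<forall>f\<in>insert e B. ?d f \<in> S"
    using dS y by (auto intro!: subspace_diff[OF S] subspace_scale[OF S])
  moreover have "\<forall>f\<in>insert e B. \<forall>g\<in>insert e B. \<gamma> (?d f) g = (if f = g then 1 else 0)"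
    using d y insert.hyps(2) by (auto simp: \<gamma>_simps)
  ultimately show ?case by (intro exI[of _ ?d] conjI)
qed

lemma dual_expansion:
  assumes \<gamma>: "bilinear_map (*) \<gamma>" and S: "subspace S" and A: "finite A"
    and sep: "\<And>v. v \<in> span A \<Longrightarrow> (\<forall>x\<in>S. \<gamma> x v = 0) \<Longrightarrow> v = 0"
  shows "\<exists>B d. finite B \<and> (\<forall>e\<in>B. d e \<in> S) \<and> (\<forall>v\<in>span A. v = (\<Sum>e\<in>B. \<gamma> (d e) v *s e))"
proof -
  obtain B where B: "B \<subseteq> A" "independent B" "A \<subseteq> span B"
    using maximal_independent_subset[of A] by blast
  have fin: "finite B" using B(1) A by (rule finite_subset)
  have span: "span A = span B"
    using B by (metis span_mono span_span subset_antisym)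
  obtain d where d: "\<forall>e\<in>B. d e \<in> S" "\<forall>e\<in>B. \<forall>f\<in>B. \<gamma> (d e) f = (if e = f then 1 else 0)"
    using dual_family[OF \<gamma> S fin B(2)] sep unfolding span by blast
  have "v = (\<Sum>e\<in>B. \<gamma> (d e) v *s e)" if v: "v \<in> span A" for v
  proof -
    obtain r where r: "v = (\<Sum>e\<in>B. r e *s e)"
      using v unfolding span span_finite[OF fin] by auto
    have "\<gamma> (d e) v = r e" if e: "e \<in> B" for e
    proof -
      have "\<gamma> (d e) v = (\<Sum>f\<in>B. r f * \<gamma> (d e) f)"
        unfolding r by (simp add: bilinear_map_sum[OF \<gamma>] bilinear_mapD[OF \<gamma>])
      also have "\<dots> = (\<Sum>f\<in>B. if f = e then r f else 0)"
        by (rule sum.cong) (use d e in auto)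
      finally show ?thesis using fin e by simp
    qed
    then show ?thesis by (subst r) (auto intro!: sum.cong)
  qed
  then show ?thesis using fin d(1) by blast
qed

end

locale nondegenerate_form = linear_space scale
  for scale :: "'a::field \<Rightarrow> 'b::ab_group_add \<Rightarrow> 'b" (infixr \<open>*s\<close> 75) +
  fixes \<beta> :: "'b \<Rightarrow> 'b \<Rightarrow> 'a"
  assumes bilinear_form: "bilinear_map (*) \<beta>"
    and form_nondegenerate: "nondegenerate \<beta>"
begin

lemmas form_simps = bilinear_mapD[OF bilinear_form] bilinear_map_diff[OF bilinear_form]
  bilinear_map_zero[OF bilinear_form] bilinear_map_sum[OF bilinear_form]

lemma form_eqI_left:
  assumes "\<And>v. \<beta> u v = \<beta> u' v"
  shows "u = u'"
proof -
  have "\<forall>v. \<beta> (u - u') v = 0" using assms by (simp add: form_simps)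
  then show ?thesis using form_nondegenerate unfolding nondegenerate_def by fastforce
qed

definition form2 :: "'b \<Rightarrow> 'b \<Rightarrow> 'b \<Rightarrow> 'b \<Rightarrow> 'a" where
  "form2 v w = (\<lambda>a b. \<beta> a v * \<beta> b w)"

definition form3 :: "'b \<Rightarrow> 'b \<Rightarrow> 'b \<Rightarrow> 'b \<Rightarrow> 'b \<Rightarrow> 'b \<Rightarrow> 'a" where
  "form3 u v w = (\<lambda>a b c. \<beta> a u * \<beta> b v * \<beta> c w)"

lemma bilinear_map_form2: "bilinear_map (*) (form2 v w)"
  unfolding form2_def by (rule bilinear_mapI[OF vector_space_mult]) (auto simp: form_simps algebra_simps)

lemma trilinear_map_form3: "trilinear_map (*) (form3 u v w)"
  unfolding form3_def by (rule trilinear_mapI[OF vector_space_mult]) (auto simp: form_simps algebra_simps)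

text \<open>
  Read as an evaluation of functionals, the pairing is linear in the tensor by construction, so it
  passes through sums.
\<close>
lemma tensor_form_tens:
  assumes t: "t \<in> tensor2"
  shows "tensor_form \<beta> t (tens v w) = t (form2 v w)"
proof -
  have B: "bilinear_map (*) (\<lambda>v1 v2. \<beta> u1 v1 * \<beta> u2 v2)" for u1 u2
    by (rule bilinear_mapI[OF vector_space_mult]) (auto simp: form_simps algebra_simps)
  have "tensor_form \<beta> t (tens v w) = lift2 (form2 v w) t"
    unfolding tensor_form_def form2_def lift2_universal(1)[OF B] by (rule refl)
  then show ?thesis using lift2_scalar[OF bilinear_map_form2 t] by simp
qed

lemma finite_expansion:
  assumes "finite A"
  shows "\<exists>B d. finite B \<and> (\<forall>v\<in>A. v = (\<Sum>e\<in>B. \<beta> v (d e) *s e))"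
proof -
  have sep: "v = 0" if "\<forall>x\<in>UNIV. \<beta> v x = 0" for v
    using that form_nondegenerate unfolding nondegenerate_def by blast
  have U: "subspace (UNIV :: 'b set)" by simp
  from dual_expansion[OF bilinear_map_flip[OF bilinear_form] U assms] sep
  obtain B d where B: "finite B" "\<forall>v\<in>span A. v = (\<Sum>e\<in>B. \<beta> v (d e) *s e)"
    by blast
  then show ?thesis using span_base[of _ A] by blast
qed

text \<open>
  Expanding the finitely many vectors that occur in a tensor along a dual family shows that
  its value at any bilinear form is a combination of its pairings with elementary tensors.
\<close>
lemma tensor2_eq_zero:
  assumes t: "t \<in> tensor2" and z: "\<And>v w. t (form2 v w) = 0"
  shows "t = 0"
proof
  fix B
  obtain xs where t: "t = (\<Sum>(v, w)\<leftarrow>xs. tens v w)" using t unfolding tensor2_iff by blast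
  show "t B = 0 B"
  proof (cases "bilinear_map (*) B")
    case False
    then show ?thesis by (simp add: t sum_list_apply split_def tens_def)
  next
    case True
    obtain E d where E: "finite E" "\<forall>v\<in>fst ` set xs \<union> snd ` set xs. v = (\<Sum>e\<in>E. \<beta> v (d e) *s e)"
      using finite_expansion[of "fst ` set xs \<union> snd ` set xs"] by auto
    have "B a b = (\<Sum>e\<in>E. \<Sum>f\<in>E. form2 (d e) (d f) a b * B e f)" if "(a, b) \<in> set xs" for a b
    proof -
      have ab: "a = (\<Sum>e\<in>E. \<beta> a (d e) *s e)" "b = (\<Sum>e\<in>E. \<beta> b (d e) *s e)"
        using that by (intro E(2)[rule_format]; force)+
      have "B a b = B (\<Sum>e\<in>E. \<beta> a (d e) *s e) (\<Sum>e\<in>E. \<beta> b (d e) *s e)"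
        by (rule arg_cong2[where f = B, OF ab])
      then show ?thesis
        unfolding bilinear_map_sum(1)[OF True] unfolding bilinear_map_sum(2)[OF True]
        by (simp add: bilinear_mapD[OF True] form2_def mult_ac)
    qed
    then have "(\<Sum>(a, b)\<leftarrow>xs. B a b) = (\<Sum>(a, b)\<leftarrow>xs. \<Sum>e\<in>E. \<Sum>f\<in>E. form2 (d e) (d f) a b * B e f)"
      by (intro arg_cong[where f = sum_list] map_cong) auto
    also have "\<dots> = (\<Sum>e\<in>E. \<Sum>f\<in>E. (\<Sum>(a, b)\<leftarrow>xs. form2 (d e) (d f) a b) * B e f)"
      by (induction xs) (auto simp: sum.distrib algebra_simps)
    also have "\<dots> = 0" using z by (simp add: t tensor2_apply[OF bilinear_map_form2])
    finally show ?thesis by (simp add: t tensor2_apply[OF True])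
  qed
qed

lemma tensor3_eq_zero:
  assumes t: "t \<in> tensor3" and z: "\<And>u v w. t (form3 u v w) = 0"
  shows "t = 0"
proof
  fix B
  obtain xs where t: "t = (\<Sum>(u, v, w)\<leftarrow>xs. tens3 u v w)" using t unfolding tensor3_iff by blast
  show "t B = 0 B"
  proof (cases "trilinear_map (*) B")
    case False
    then show ?thesis by (simp add: t sum_list_apply split_def tens3_def)
  next
    case True
    define A where "A = fst ` set xs \<union> (fst \<circ> snd) ` set xs \<union> (snd \<circ> snd) ` set xs"
    obtain E d where E: "finite E" "\<forall>v\<in>A. v = (\<Sum>e\<in>E. \<beta> v (d e) *s e)"
      using finite_expansion[of A] by (auto simp: A_def)
    note lin = True[unfolded trilinear_map_def]
    have B_sum: "B (sum h E) b c = (\<Sum>e\<in>E. B (h e) b c)" "B a (sum h E) c = (\<Sum>e\<in>E. B a (h e) c)"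
      "B a b (sum h E) = (\<Sum>e\<in>E. B a b (h e))" for a b c h
      using linear_sum[OF lin[THEN conjunct1, rule_format]]
        linear_sum[OF lin[THEN conjunct2, THEN conjunct1, rule_format]]
        linear_sum[OF lin[THEN conjunct2, THEN conjunct2, rule_format]] by auto
    have "B a b c = (\<Sum>e\<in>E. \<Sum>f\<in>E. \<Sum>g\<in>E. form3 (d e) (d f) (d g) a b c * B e f g)"
      if "(a, b, c) \<in> set xs" for a b c
    proof -
      have A: "a \<in> A" "b \<in> A" "c \<in> A" using that unfolding A_def by force+
      note abc = E(2)[rule_format, OF A(1)] E(2)[rule_format, OF A(2)] E(2)[rule_format, OF A(3)]
      have "B a b c = B (\<Sum>e\<in>E. \<beta> a (d e) *s e) (\<Sum>e\<in>E. \<beta> b (d e) *s e) (\<Sum>e\<in>E. \<beta> c (d e) *s e)"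
        by (subst abc(1), subst abc(2), subst abc(3)) (rule refl)
      then show ?thesis
        unfolding B_sum(1) unfolding B_sum(2) unfolding B_sum(3)
        by (simp add: trilinear_mapD[OF True] form3_def mult_ac)
    qed
    then have "(\<Sum>(a, b, c)\<leftarrow>xs. B a b c) =
        (\<Sum>(a, b, c)\<leftarrow>xs. \<Sum>e\<in>E. \<Sum>f\<in>E. \<Sum>g\<in>E. form3 (d e) (d f) (d g) a b c * B e f g)"
      by (intro arg_cong[where f = sum_list] map_cong) auto
    also have "\<dots> = (\<Sum>e\<in>E. \<Sum>f\<in>E. \<Sum>g\<in>E. (\<Sum>(a, b, c)\<leftarrow>xs. form3 (d e) (d f) (d g) a b c) * B e f g)"
      by (induction xs) (auto simp: sum.distrib algebra_simps)
    also have "\<dots> = 0" using z by (simp add: t tensor3_apply[OF trilinear_map_form3])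
    finally show ?thesis by (simp add: t tensor3_apply[OF True])
  qed
qed

lemma tensor2_eqI:
  assumes "s \<in> tensor2" "t \<in> tensor2" "\<And>v w. s (form2 v w) = t (form2 v w)"
  shows "s = t"
proof -
  interpret T: vector_space "fun_scale :: 'a \<Rightarrow> (('b \<Rightarrow> 'b \<Rightarrow> 'a) \<Rightarrow> 'a) \<Rightarrow> _"
    by (rule vector_space_fun_scale)
  have "s - t = 0"
    by (rule tensor2_eq_zero) (use assms in \<open>simp_all add: T.subspace_diff[OF subspace_tensor2]\<close>)
  then show ?thesis by simp
qed

lemma tensor3_eqI:
  assumes "s \<in> tensor3" "t \<in> tensor3" "\<And>u v w. s (form3 u v w) = t (form3 u v w)"
  shows "s = t"
proof -
  interpret T: vector_space "fun_scale :: 'a \<Rightarrow> (('b \<Rightarrow> 'b \<Rightarrow> 'b \<Rightarrow> 'a) \<Rightarrow> 'a) \<Rightarrow> _"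
    by (rule vector_space_fun_scale)
  have "s - t = 0"
    by (rule tensor3_eq_zero) (use assms in \<open>simp_all add: T.subspace_diff[OF subspace_tensor3]\<close>)
  then show ?thesis by simp
qed

lemma bilinear_map_pairing:
  assumes "t \<in> tensor2"
  shows "bilinear_map (*) (\<lambda>v w. t (form2 v w))"
proof -
  obtain xs where t: "t = (\<Sum>(v, w)\<leftarrow>xs. tens v w)" using assms unfolding tensor2_iff by blast
  show ?thesis
    by (rule bilinear_mapI[OF vector_space_mult])
      (simp_all add: t tensor2_apply[OF bilinear_map_form2], simp_all add: form2_def form_simps
        split_def sum_list_addf sum_list_const_mult[symmetric] algebra_simps)
qed

lemma form_functional_id:
  assumes "t \<in> tensor2"
  shows "\<beta> (functional_id (\<lambda>v. \<beta> v x) t) w = t (form2 x w)"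
proof -
  have B: "bilinear_map scale (\<lambda>a b. \<beta> a x *s b)"
    by (rule bilinear_mapI[OF vector_space_axioms])
      (simp_all add: form_simps scale_left_distrib scale_right_distrib mult_ac)
  show ?thesis
    unfolding functional_id_def functional_lift2[OF B bilinear_map_linear(2)[OF bilinear_form] assms]
    by (simp add: form2_def form_simps)
qed

lemma form_id_functional:
  assumes "t \<in> tensor2"
  shows "\<beta> (id_functional (\<lambda>v. \<beta> v x) t) w = t (form2 w x)"
proof -
  have B: "bilinear_map scale (\<lambda>a b. \<beta> b x *s a)"
    by (rule bilinear_mapI[OF vector_space_axioms])
      (simp_all add: form_simps scale_left_distrib scale_right_distrib mult_ac)
  show ?thesis
    unfolding id_functional_def functional_lift2[OF B bilinear_map_linear(2)[OF bilinear_form] assms]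
    by (simp add: form2_def form_simps mult.commute)
qed

end


section \<open>Graded vector spaces\<close>

lemma (in linear_space) linear_Sum_any:
  assumes "Vector_Spaces.linear s s' f" "finite {i. g i \<noteq> 0}"
  shows "f (Sum_any g) = Sum_any (\<lambda>i. f (g i))"
proof -
  have "{i. f (g i) \<noteq> 0} \<subseteq> {i. g i \<noteq> 0}" by (auto simp: linearD(3)[OF assms(1)])
  then show ?thesis
    by (simp add: Sum_any.expand_superset[OF assms(2)] linear_sum[OF assms(1)])
qed

context graded_vector_space
begin

lemma homogeneous_decomposition:
  obtains K f where "finite K" "\<And>k. f k \<in> G k" "v = (\<Sum>k\<in>K. f k)"
proof -
  obtain f where f: "\<forall>k. f k \<in> G k" "finite {k. f k \<noteq> 0}" "v = Sum_any f"
    using direct_sum by blast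
  then show thesis using that[of "{k. f k \<noteq> 0}" f] by (simp add: Sum_any.expand_set)
qed

lemma linear_eq_on_homogeneous:
  assumes "Vector_Spaces.linear scale s \<phi>" "Vector_Spaces.linear scale s \<psi>"
    and "\<And>k v. v \<in> G k \<Longrightarrow> \<phi> v = \<psi> v"
  shows "\<phi> v = \<psi> v"
proof -
  obtain K f where f: "finite K" "\<And>k. f k \<in> G k" "v = (\<Sum>k\<in>K. f k)"
    using homogeneous_decomposition by blast
  then show ?thesis
    by (simp add: linear_sum[OF assms(1)] linear_sum[OF assms(2)] assms(3)[OF f(2)])
qed

lemma bilinear_eq_on_homogeneous:
  assumes B: "bilinear_map s B" and C: "bilinear_map s C"
    and "\<And>a b v w. v \<in> G a \<Longrightarrow> w \<in> G b \<Longrightarrow> B v w = C v w"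
  shows "B v w = C v w"
proof -
  have "B v w = C v w" if "v \<in> G a" for a v w
    by (rule linear_eq_on_homogeneous[OF bilinear_map_linear(1)[OF B] bilinear_map_linear(1)[OF C]])
      (use assms(3) that in blast)
  then show ?thesis
    using linear_eq_on_homogeneous[OF bilinear_map_linear(2)[OF B] bilinear_map_linear(2)[OF C]] by blast
qed

lemma homogeneous_components_unique:
  assumes "\<And>k. f k \<in> G k" "finite {k. f k \<noteq> 0}" "\<And>k. g k \<in> G k" "finite {k. g k \<noteq> 0}"
    and "Sum_any f = Sum_any g"
  shows "f = g"
proof -
  obtain h where h: "\<And>h'. (\<forall>k. h' k \<in> G k) \<and> finite {k. h' k \<noteq> 0} \<and> Sum_any f = Sum_any h' \<Longrightarrow> h' = h"
    using direct_sum[of "Sum_any f"] by (elim ex1E) blast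
  show ?thesis using h[of f] h[of g] assms by simp
qed

text \<open>
  Here characteristic zero enters: the integers \<open>k\<close> are then distinct as eigenvalues, so the
  homogeneous components of an eigenvector other than the matching one vanish.
\<close>
lemma homogeneous_iff_eigenvector:
  assumes char: "CHAR('a) = 0" and L: "Vector_Spaces.linear scale scale L"
    and eig: "\<And>k v. v \<in> G k \<Longrightarrow> L v = of_int k *s v"
  shows "v \<in> G m \<longleftrightarrow> L v = of_int m *s v"
proof
  assume v: "L v = of_int m *s v"
  obtain f where f: "\<forall>k. f k \<in> G k" "finite {k. f k \<noteq> 0}" "v = Sum_any f"
    using direct_sum by blast
  have supp: "finite {k. r k *s f k \<noteq> 0}" for r
    by (rule finite_subset[OF _ f(2)]) auto
  have scaled: "of_int m *s v = Sum_any (\<lambda>k. of_int m *s f k)"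
    unfolding f(3) by (rule linear_Sum_any[OF linear_scale_self f(2)])
  have "L v = Sum_any (\<lambda>k. of_int k *s f k)"
    unfolding f(3) linear_Sum_any[OF L f(2)] by (simp add: eig[OF f(1)[rule_format]])
  then have "of_int m *s v = Sum_any (\<lambda>k. of_int k *s f k)" using v by simp
  then have "(\<lambda>k. of_int k *s f k) = (\<lambda>k. of_int m *s f k)"
    using f(1) scaled by (intro homogeneous_components_unique supp subspace_scale[OF subspace_G]) auto
  then have "(of_int (k - m) :: 'a) *s f k = 0" for k
    by (auto simp: fun_eq_iff scale_left_diff_distrib)
  moreover have "(of_int (k - m) :: 'a) \<noteq> 0" if "k \<noteq> m" for k
    using that of_int_eq_0_iff_char_dvd[where 'a = 'a, of "k - m"] char by simp
  ultimately have "f k = 0" if "k \<noteq> m" for k using that by auto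
  then have "{k. f k \<noteq> 0} \<subseteq> {m}" by auto
  then have "v = f m" unfolding f(3) by (subst Sum_any.expand_superset[of "{m}"]) auto
  then show "v \<in> G m" using f(1) by simp
qed (rule eig)

end


section \<open>Weights in characteristic zero\<close>

lemma int_choose_eq_zero: "0 \<le> n \<Longrightarrow> n < int k \<Longrightarrow> int_choose n k = 0"
proof -
  assume n: "0 \<le> n" "n < int k"
  have "(\<Prod>i = 0..<k. n - of_nat i) = 0"
    by (rule prod_zero) (use n in \<open>auto intro!: bexI[of _ "nat n"]\<close>)
  then show ?thesis unfolding int_choose_def by (simp only: div_0)
qed

context vertex_operator_algebra
begin

lemma Y_linear: "Vector_Spaces.linear scale scale (Y v n)"
  using bilinear_map_linear(1)[OF Y_bilinear] .

lemma virasoro_mode_linear: "Vector_Spaces.linear scale scale (virasoro_mode Y \<omega> k)"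
  unfolding virasoro_mode_def by (rule Y_linear)

text \<open>
  The coefficient of \<open>x0\<^sup>-\<^sup>1 x1\<^sup>-\<^sup>2\<close> in the Jacobi identity is the commutator of a
  vertex operator with \<open>L(0)\<close>; only two terms of the iterate survive.
\<close>
lemma weight_commutator:
  "virasoro_mode Y \<omega> 0 (Y v n w) =
     Y v n (virasoro_mode Y \<omega> 0 w) + Y (virasoro_mode Y \<omega> 0 v) n w + of_int n *s Y v n w"
proof -
  have dq: "delta_quotient \<epsilon> (- 1) j k = (if j = 0 \<and> k = 0 then 1 else 0 :: 'a)" for \<epsilon> j k
  proof (cases "0 < k")
    case True
    then show ?thesis using int_choose_eq_zero[of 0 "nat k"]
      by (simp add: delta_quotient_def diff_power_def)
  next
    case False
    then show ?thesis by (auto simp: delta_quotient_def diff_power_def int_choose_def)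
  qed
  have prod1: "series_mult scale (\<lambda>a b c. delta_quotient 1 a b c)
      (\<lambda>a b c. if a = 0 then A b c else 0) (- 1) b c = A b c" for A b c
  proof -
    have "(case p of (i, j, k) \<Rightarrow> delta_quotient 1 i j k *s
        (if (- 1 :: int) - i = 0 then A (b - j) (c - k) else 0)) =
        (if p = (- 1, 0, 0) then A b c else 0)" for p
      by (cases p) (auto simp: dq)
    then show ?thesis unfolding series_mult_def by simp
  qed
  have prod2: "series_mult scale (\<lambda>a b c. delta_quotient (- 1) a c b)
      (\<lambda>a b c. if a = 0 then A b c else 0) (- 1) b c = A b c" for A b c
  proof -
    have "(case p of (i, j, k) \<Rightarrow> delta_quotient (- 1) i k j *s
        (if (- 1 :: int) - i = 0 then A (b - j) (c - k) else 0)) =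
        (if p = (- 1, 0, 0) then A b c else 0)" for p
      by (cases p) (auto simp: dq)
    then show ?thesis unfolding series_mult_def by simp
  qed
  have dq2: "delta_quotient 1 k (- 2) i =
      (if (i, k) = (0, 1) \<or> (i, k) = (1, 0) then 1 else 0 :: 'a)" for i k
  proof (cases "2 \<le> i")
    case True
    have "int_choose (- k - 1) (nat i) = 0" if "j + i = - k - 1" "j = - 2" for j
      by (rule int_choose_eq_zero) (use that True in auto)
    then show ?thesis using True by (auto simp: delta_quotient_def diff_power_def)
  next
    case False
    then have "i < 0 \<or> i = 0 \<or> i = 1" by auto
    then show ?thesis by (auto simp: delta_quotient_def diff_power_def int_choose_def)
  qed
  have prod3: "series_mult scale (\<lambda>a b c. delta_quotient 1 c b a)
      (\<lambda>a b c. if b = 0 then A a c else 0) (- 1) (- 2) c = A (- 1) (c - 1) + A (- 2) c" for A c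
  proof -
    have "(case p of (i, j, k) \<Rightarrow> delta_quotient 1 k j i *s
        (if (- 2 :: int) - j = 0 then A (- 1 - i) (c - k) else 0)) =
        (if p = (0, - 2, 1) then A (- 1) (c - 1) else if p = (1, - 2, 0) then A (- 2) c else 0)" for p
      by (cases p) (auto simp: dq2)
    then have "series_mult scale (\<lambda>a b c. delta_quotient 1 c b a)
        (\<lambda>a b c. if b = 0 then A a c else 0) (- 1) (- 2) c =
        Sum_any (\<lambda>p. if p = (0 :: int, - 2 :: int, 1 :: int) then A (- 1) (c - 1) else if p = (1, - 2, 0) then A (- 2) c else 0)"
      unfolding series_mult_def by simp
    also have "\<dots> = A (- 1) (c - 1) + A (- 2) c"
      by (subst Sum_any.expand_superset[of "{(0, - 2, 1), (1, - 2, 0)}"]) auto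
    finally show ?thesis .
  qed
  have "Y \<omega> (- 2) (Y v n w) - Y v n (Y \<omega> (- 2) w) =
      Y (Y \<omega> (- 1) v) (n - 1) w + Y (Y \<omega> (- 2) v) n w"
    using jacobi[of \<omega> v w "- 1" "- 2" n] unfolding prod1 prod2 prod3 .
  moreover have "of_int n *s Y v n w = Y (Y \<omega> (- 1) v) (n - 1) w"
    using derivative[of "n - 1" v w] by (simp add: virasoro_mode_def)
  ultimately show ?thesis by (simp add: virasoro_mode_def algebra_simps)
qed

text \<open>
  The operator \<open>L(0)\<close> is self-adjoint for the form, so its eigenspaces for distinct eigenvalues are
  orthogonal; and the commutator with \<open>L(0)\<close> shows that a mode of a homogeneous vector maps
  eigenvectors to eigenvectors.
\<close>
lemma weight_compatible_char_0:
  assumes char: "CHAR('a) = 0" and \<beta>: "bilinear_map (*) \<beta>" and pres: "virasoro_preserving Y \<omega> \<beta>"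
  shows "weight_compatible G Y \<beta>"
proof -
  note hom = homogeneous_iff_eigenvector[OF char virasoro_mode_linear grading]
  have "Y v (- k - 1) w \<in> G (a + b - k - 1)" if "v \<in> G a" "w \<in> G b" for v w a b k
  proof (rule hom[THEN iffD2])
    show "virasoro_mode Y \<omega> 0 (Y v (- k - 1) w) = of_int (a + b - k - 1) *s Y v (- k - 1) w"
      unfolding weight_commutator grading[OF that(1)] grading[OF that(2)]
      by (simp add: bilinear_mapD[OF Y_bilinear] scale_left_distrib scale_left_diff_distrib)
  qed
  moreover have "\<beta> v w = 0" if "a \<noteq> b" "v \<in> G a" "w \<in> G b" for v w a b
  proof -
    have "\<beta> (virasoro_mode Y \<omega> 0 v) w = \<beta> v (virasoro_mode Y \<omega> 0 w)"
      using pres unfolding virasoro_preserving_def by (metis minus_zero)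
    then have "of_int (a - b) * \<beta> v w = 0"
      using that by (simp add: grading bilinear_mapD[OF \<beta>] algebra_simps)
    moreover have "(of_int (a - b) :: 'a) \<noteq> 0"
      using that of_int_eq_0_iff_char_dvd[where 'a = 'a, of "a - b"] char by simp
    ultimately show ?thesis by simp
  qed
  ultimately show ?thesis unfolding weight_compatible_def by blast
qed

end


section \<open>The adjoint coproduct\<close>

locale weighted_form = graded_vector_space scale G + nondegenerate_form scale \<beta>
  for scale :: "'a::field \<Rightarrow> 'v::ab_group_add \<Rightarrow> 'v" (infixr \<open>*s\<close> 75)
    and G :: "int \<Rightarrow> 'v set" and \<beta> :: "'v \<Rightarrow> 'v \<Rightarrow> 'a" +
  assumes orthogonal: "a \<noteq> b \<Longrightarrow> v \<in> G a \<Longrightarrow> w \<in> G b \<Longrightarrow> \<beta> v w = 0"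
begin

text \<open>
  By orthogonality of the weight spaces, the nondegenerate form stays nondegenerate on each of them,
  so the dual vectors can be chosen of the same weight.
\<close>
lemma homogeneous_dual_expansion:
  "\<exists>B d. finite B \<and> (\<forall>e\<in>B. d e \<in> G a) \<and> (\<forall>v\<in>G a. v = (\<Sum>e\<in>B. \<beta> (d e) v *s e))"
proof -
  obtain A where A: "finite A" "span A = G a" using finite_dim by blast
  have "v = 0" if v: "v \<in> G a" "\<forall>x\<in>G a. \<beta> x v = 0" for v
  proof -
    have "\<beta> x v = 0" for x
    proof -
      have z: "Vector_Spaces.linear scale (*) (\<lambda>_. 0 :: 'a)"
        by (rule linearI[OF vector_space_mult]) auto
      show ?thesis
        using linear_eq_on_homogeneous[OF bilinear_map_linear(2)[OF bilinear_form] z] v orthogonal by metis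
    qed
    then show ?thesis using form_nondegenerate unfolding nondegenerate_def by blast
  qed
  then show ?thesis
    using dual_expansion[OF bilinear_form subspace_G A(1), of a] unfolding A(2) by blast
qed

text \<open>
  On the finitely many pairs of weights that matter, the form identifies each finite-dimensional
  weight space with its dual, so the coefficients of \<open>B\<close> along dual bases give the tensor.
\<close>
lemma bilinear_form_representable:
  assumes B: "bilinear_map (*) B" and P: "finite P"
    and supp: "\<And>a b v w. (a, b) \<notin> P \<Longrightarrow> v \<in> G a \<Longrightarrow> w \<in> G b \<Longrightarrow> B v w = 0"
  shows "\<exists>t\<in>tensor2. \<forall>v w. t (form2 v w) = B v w"
proof -
  have "\<forall>a. \<exists>E d. finite E \<and> (\<forall>e\<in>E. d e \<in> G a) \<and> (\<forall>v\<in>G a. v = (\<Sum>e\<in>E. \<beta> (d e) v *s e))"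
    using homogeneous_dual_expansion by blast
  then obtain E d where E: "\<And>a. finite (E a)" "\<And>a e. e \<in> E a \<Longrightarrow> d a e \<in> G a"
    "\<And>a v. v \<in> G a \<Longrightarrow> v = (\<Sum>e\<in>E a. \<beta> (d a e) v *s e)"
    unfolding choice_iff by blast
  interpret T: vector_space "fun_scale :: 'a \<Rightarrow> (('v \<Rightarrow> 'v \<Rightarrow> 'a) \<Rightarrow> 'a) \<Rightarrow> _"
    by (rule vector_space_fun_scale)
  define t where "t = (\<Sum>(a, b)\<in>P. \<Sum>e\<in>E a. \<Sum>f\<in>E b. fun_scale (B e f) (tens (d a e) (d b f)))"
  have t: "t \<in> tensor2"
    unfolding t_def
    by (auto intro!: T.subspace_sum[OF subspace_tensor2] T.subspace_scale[OF subspace_tensor2] tens_in_tensor2)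
  have t_apply: "t (form2 v w) =
      (\<Sum>(a, b)\<in>P. \<Sum>e\<in>E a. \<Sum>f\<in>E b. B e f * (\<beta> (d a e) v * \<beta> (d b f) w))" for v w
    unfolding t_def
    by (simp add: linear_sum[OF linear_eval] split_def fun_scale_def tens_def bilinear_map_form2)
      (simp add: form2_def)
  have hom: "t (form2 v w) = B v w" if vw: "v \<in> G a" "w \<in> G b" for v w a b
  proof -
    have "(\<Sum>e\<in>E a'. \<Sum>f\<in>E b'. B e f * (\<beta> (d a' e) v * \<beta> (d b' f) w)) =
        (if (a', b') = (a, b) then B v w else 0)" for a' b'
    proof (cases "(a', b') = (a, b)")
      case False
      have "\<beta> (d a' e) v * \<beta> (d b' f) w = 0" if "e \<in> E a'" "f \<in> E b'" for e f
        using False orthogonal[OF _ E(2)[OF that(1)] vw(1)] orthogonal[OF _ E(2)[OF that(2)] vw(2)] by auto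
      then have "(\<Sum>e\<in>E a'. \<Sum>f\<in>E b'. B e f * (\<beta> (d a' e) v * \<beta> (d b' f) w)) = 0"
        by (intro sum.neutral ballI) simp
      then show ?thesis unfolding if_not_P[OF False] .
    next
      case True
      have "B v w = B (\<Sum>e\<in>E a. \<beta> (d a e) v *s e) (\<Sum>f\<in>E b. \<beta> (d b f) w *s f)"
        by (rule arg_cong2[where f = B, OF E(3)[OF vw(1)] E(3)[OF vw(2)]])
      also have "\<dots> = (\<Sum>e\<in>E a. \<Sum>f\<in>E b. B e f * (\<beta> (d a e) v * \<beta> (d b f) w))"
        unfolding bilinear_map_sum(1)[OF B] unfolding bilinear_map_sum(2)[OF B]
        by (simp add: bilinear_mapD[OF B] mult_ac)
      finally show ?thesis using True by simp
    qed
    then have "t (form2 v w) = (\<Sum>p\<in>P. if p = (a, b) then B v w else 0)"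
      unfolding t_apply by (intro sum.cong) (auto split: if_splits)
    also have "\<dots> = B v w" using P supp vw by auto
    finally show ?thesis .
  qed
  have "t (form2 v w) = B v w" for v w
    by (rule bilinear_eq_on_homogeneous[OF bilinear_map_pairing[OF t] B hom])
  then show ?thesis using t by blast
qed

end

locale voa_with_form = vertex_operator_algebra scale G Y vac \<omega> d + nondegenerate_form scale \<beta>
  for scale :: "'a::field \<Rightarrow> 'v::ab_group_add \<Rightarrow> 'v" (infixr \<open>*s\<close> 75)
    and G :: "int \<Rightarrow> 'v set" and Y :: "'v \<Rightarrow> int \<Rightarrow> 'v \<Rightarrow> 'v" and vac \<omega> :: 'v and d :: 'a
    and \<beta> :: "'v \<Rightarrow> 'v \<Rightarrow> 'a" +
  assumes preserving: "virasoro_preserving Y \<omega> \<beta>"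
    and compatible: "weight_compatible G Y \<beta>"
begin

sublocale weighted_form scale G \<beta>
  using compatible unfolding weight_compatible_def by unfold_locales blast

lemma mode_weight:
  assumes "v \<in> G a" "w \<in> G b"
  shows "Y v n w \<in> G (a + b + n)"
proof -
  have "Y v (- (- n - 1) - 1) w \<in> G (a + b - (- n - 1) - 1)"
    using compatible assms unfolding weight_compatible_def by blast
  then show ?thesis by (simp add: add.assoc)
qed

lemma bilinear_map_matrix_coefficient: "bilinear_map (*) (\<lambda>v w. \<beta> u (Y v n w))"
  by (rule bilinear_map_compose[OF Y_bilinear bilinear_map_linear(1)[OF bilinear_form]])

text \<open>
  A vector \<open>u\<close> has components in finitely many weights, and \<open>Y v n w\<close> has weight \<open>a + b + n\<close>; since the
  weights \<open>a\<close> and \<open>b\<close> are bounded below, only finitely many pairs contribute for each \<open>n\<close>, and none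
  for large \<open>n\<close>. The first consequence gives existence of the coproduct, the second its truncation.
\<close>
lemma matrix_coefficient_support:
  obtains K N where "finite K" and "\<And>n a b v w. v \<in> G a \<Longrightarrow> w \<in> G b \<Longrightarrow>
    \<not> (N \<le> a \<and> N \<le> b \<and> a + b + n \<in> K) \<Longrightarrow> \<beta> u (Y v n w) = 0"
proof -
  obtain K f where f: "finite K" "\<And>k. f k \<in> G k" "u = (\<Sum>k\<in>K. f k)"
    using homogeneous_decomposition by blast
  obtain N where N: "\<forall>k<N. G k = {0}" using bounded_below by blast
  have "\<beta> u (Y v n w) = 0"
    if vw: "v \<in> G a" "w \<in> G b" and far: "\<not> (N \<le> a \<and> N \<le> b \<and> a + b + n \<in> K)" for n a b v w
  proof -
    have "a < N \<Longrightarrow> v = 0" "b < N \<Longrightarrow> w = 0" using vw N by auto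
    then consider "v = 0 \<or> w = 0" | "a + b + n \<notin> K" using far by force
    then show ?thesis
    proof cases
      case 1
      then show ?thesis using bilinear_map_zero[OF bilinear_map_matrix_coefficient] by metis
    next
      case 2
      have "\<beta> (f k) (Y v n w) = 0" if "k \<in> K" for k
        by (rule orthogonal[OF _ f(2) mode_weight[OF vw]]) (use that 2 in blast)
      then show ?thesis unfolding f(3) bilinear_map_sum[OF bilinear_form] by (intro sum.neutral ballI)
    qed
  qed
  then show thesis by (rule that[OF f(1)])
qed

lemma matrix_coefficient_truncation: "\<exists>M. \<forall>n>M. \<forall>v w. \<beta> u (Y v n w) = 0"
proof (rule matrix_coefficient_support[of u])
  fix N K assume K: "finite K" "\<And>n a b v w. v \<in> G a \<Longrightarrow> w \<in> G b \<Longrightarrow>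
      \<not> (N \<le> a \<and> N \<le> b \<and> a + b + n \<in> K) \<Longrightarrow> \<beta> u (Y v n w) = 0"
  obtain M where M: "\<forall>k\<in>K. k \<le> M"
    using bdd_above_finite[OF K(1)] unfolding bdd_above_def by blast
  have zero: "bilinear_map (*) (\<lambda>(v::'v) (w::'v). 0 :: 'a)"
    by (rule bilinear_mapI[OF vector_space_mult]) auto
  have "\<beta> u (Y v n w) = 0" if "n > M - 2 * N" for n v w
  proof (rule bilinear_eq_on_homogeneous[OF bilinear_map_matrix_coefficient zero])
    fix a b v w assume vw: "v \<in> G a" "w \<in> G b"
    have "\<not> (N \<le> a \<and> N \<le> b \<and> a + b + n \<in> K)"
    proof
      assume *: "N \<le> a \<and> N \<le> b \<and> a + b + n \<in> K"
      then have "a + b + n \<le> M" using M by blast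
      with * that show False by linarith
    qed
    with vw show "\<beta> u (Y v n w) = 0" by (rule K(2))
  qed
  then show ?thesis by blast
qed

lemma coproduct_value_exists: "\<exists>t\<in>tensor2. \<forall>v w. t (form2 v w) = \<beta> u (Y v n w)"
proof (rule matrix_coefficient_support[of u])
  fix N K assume K: "finite K" "\<And>n a b v w. v \<in> G a \<Longrightarrow> w \<in> G b \<Longrightarrow>
      \<not> (N \<le> a \<and> N \<le> b \<and> a + b + n \<in> K) \<Longrightarrow> \<beta> u (Y v n w) = 0"
  let ?P = "{(a, b). N \<le> a \<and> N \<le> b \<and> a + b + n \<in> K}"
  obtain M where M: "\<forall>k\<in>K. k \<le> M"
    using bdd_above_finite[OF K(1)] unfolding bdd_above_def by blast
  have "?P \<subseteq> {N..M - N - n} \<times> {N..M - N - n}" using M by force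
  then have "finite ?P" by (rule finite_subset) auto
  from bilinear_form_representable[OF bilinear_map_matrix_coefficient this]
  show ?thesis using K(2) by simp
qed

lemma adjoint_coproduct_iff:
  "adjoint_coproduct \<beta> Y Ups \<longleftrightarrow>
     (\<forall>n u. Ups n u \<in> tensor2 \<and> (\<forall>v w. Ups n u (form2 v w) = \<beta> u (Y v n w)))"
  unfolding adjoint_coproduct_def using tensor_form_tens by metis

lemma adjoint_coproduct_unique_existence: "\<exists>!Ups. adjoint_coproduct \<beta> Y Ups"
proof -
  have "\<exists>!t. t \<in> tensor2 \<and> (\<forall>v w. t (form2 v w) = \<beta> u (Y v n w))" for n u
    using coproduct_value_exists[of u n] tensor2_eqI by (metis (no_types, lifting))
  then have ex1: "\<forall>n u. \<exists>!t. t \<in> tensor2 \<and> (\<forall>v w. t (form2 v w) = \<beta> u (Y v n w))" by blast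
  then have "\<exists>Ups. adjoint_coproduct \<beta> Y Ups" unfolding adjoint_coproduct_iff by metis
  moreover have "Ups = Ups'" if "adjoint_coproduct \<beta> Y Ups" "adjoint_coproduct \<beta> Y Ups'" for Ups Ups'
    using that ex1 unfolding adjoint_coproduct_iff by (intro ext) metis
  ultimately show ?thesis by blast
qed

end


section \<open>Finiteness of the products with delta functions\<close>

text \<open>
  In each term of the Jacobi identity the summation runs along a line on which one exponent of
  the series tends to infinity and another to minus infinity. Truncation in a vertex operator
  algebra controls the decreasing exponent, truncation in a coalgebra the increasing one; the common
  hypothesis used here asks for vanishing only when both are far out.
\<close>
lemma finite_delta_supports:
  fixes s :: "'a::field \<Rightarrow> 'w::ab_group_add \<Rightarrow> 'w"
  assumes s: "vector_space s"
    and B: "\<exists>M. \<forall>p q. M < p \<longrightarrow> q < - M \<longrightarrow> B p q = 0"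
  shows "finite {(i, j, k). s (delta_quotient 1 i j k) (if a - i = 0 then B (b - j) (c - k) else 0) \<noteq> 0}"
    and "finite {(i, j, k). s (delta_quotient (- 1) i k j) (if a - i = 0 then B (c - k) (b - j) else 0) \<noteq> 0}"
    and "finite {(i, j, k). s (delta_quotient 1 k j i) (if b - j = 0 then B (c - k) (a - i) else 0) \<noteq> 0}"
proof -
  interpret vector_space s by fact
  obtain M where M: "\<And>p q. M < p \<Longrightarrow> q < - M \<Longrightarrow> B p q = 0" using B by blast
  have supp: "0 \<le> k \<and> j = - i - 1 - k" if "delta_quotient \<epsilon> i j k \<noteq> 0" for \<epsilon> :: 'a and i j k
    using that by (auto simp: delta_quotient_def diff_power_def split: if_splits)
  have fin: "finite {n. 0 \<le> n \<and> B (p + n) (q - n) \<noteq> 0}" for p q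
  proof (rule finite_subset)
    show "{n. 0 \<le> n \<and> B (p + n) (q - n) \<noteq> 0} \<subseteq> {0..max (M - p) (M + q)}"
      using M by (force simp: max_def)
  qed simp
  show "finite {(i, j, k). s (delta_quotient 1 i j k) (if a - i = 0 then B (b - j) (c - k) else 0) \<noteq> 0}" (is "finite ?S")
  proof (rule finite_subset)
    show "?S \<subseteq> (\<lambda>n. (a, - a - 1 - n, n)) ` {n. 0 \<le> n \<and> B (b + a + 1 + n) (c - n) \<noteq> 0}"
    proof
      fix p assume "p \<in> ?S"
      then obtain i j k where p: "p = (i, j, k)" and nz: "s (delta_quotient 1 i j k) (if a - i = 0 then B (b - j) (c - k) else 0) \<noteq> 0" by auto
      then have K: "delta_quotient 1 i j k \<noteq> (0 :: 'a)" and "a - i = 0" and "B (b - j) (c - k) \<noteq> 0"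
        by (auto split: if_splits)
      then show "p \<in> (\<lambda>n. (a, - a - 1 - n, n)) ` {n. 0 \<le> n \<and> B (b + a + 1 + n) (c - n) \<noteq> 0}"
        unfolding p using supp[OF K] by (intro image_eqI[of _ _ k]) (auto simp: algebra_simps)
    qed
  qed (rule finite_imageI[OF fin])
  show "finite {(i, j, k). s (delta_quotient (- 1) i k j) (if a - i = 0 then B (c - k) (b - j) else 0) \<noteq> 0}" (is "finite ?S")
  proof (rule finite_subset)
    show "?S \<subseteq> (\<lambda>n. (a, n, - a - 1 - n)) ` {n. 0 \<le> n \<and> B (c + a + 1 + n) (b - n) \<noteq> 0}"
    proof
      fix p assume "p \<in> ?S"
      then obtain i j k where p: "p = (i, j, k)" and nz: "s (delta_quotient (- 1) i k j) (if a - i = 0 then B (c - k) (b - j) else 0) \<noteq> 0" by auto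
      then have K: "delta_quotient (- 1) i k j \<noteq> (0 :: 'a)" and "a - i = 0" and "B (c - k) (b - j) \<noteq> 0"
        by (auto split: if_splits)
      then show "p \<in> (\<lambda>n. (a, n, - a - 1 - n)) ` {n. 0 \<le> n \<and> B (c + a + 1 + n) (b - n) \<noteq> 0}"
        unfolding p using supp[OF K] by (intro image_eqI[of _ _ j]) (auto simp: algebra_simps)
    qed
  qed (rule finite_imageI[OF fin])
  show "finite {(i, j, k). s (delta_quotient 1 k j i) (if b - j = 0 then B (c - k) (a - i) else 0) \<noteq> 0}" (is "finite ?S")
  proof (rule finite_subset)
    show "?S \<subseteq> (\<lambda>n. (n, b, - b - 1 - n)) ` {n. 0 \<le> n \<and> B (c + b + 1 + n) (a - n) \<noteq> 0}"
    proof
      fix p assume "p \<in> ?S"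
      then obtain i j k where p: "p = (i, j, k)" and nz: "s (delta_quotient 1 k j i) (if b - j = 0 then B (c - k) (a - i) else 0) \<noteq> 0" by auto
      then have K: "delta_quotient 1 k j i \<noteq> (0 :: 'a)" and "b - j = 0" and "B (c - k) (a - i) \<noteq> 0"
        by (auto split: if_splits)
      moreover from this have "j = b" "0 \<le> i" "k = - b - 1 - i" "c - k = c + b + 1 + i"
        using supp[OF K] by auto
      ultimately show "p \<in> (\<lambda>n. (n, b, - b - 1 - n)) ` {n. 0 \<le> n \<and> B (c + b + 1 + n) (a - n) \<noteq> 0}"
        unfolding p by (intro image_eqI[of _ _ i]) (simp_all add: algebra_simps)
    qed
  qed (rule finite_imageI[OF fin])
qed

context linear_space
begin

text \<open>
  A functional can be moved inside the sum when the summands have finite support in the space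
  itself; finite support of their values would not be enough, hence one assumption for each side.
\<close>
lemma series_mult_compare:
  assumes \<phi>: "Vector_Spaces.linear s (*) \<phi>" and \<psi>: "Vector_Spaces.linear s' (*) \<psi>"
    and "finite {(i, j, k). s (K i j k) (A (a - i) (b - j) (c - k)) \<noteq> 0}"
    and "finite {(i, j, k). s' (K i j k) (B (a - i) (b - j) (c - k)) \<noteq> 0}"
    and eq: "\<And>a b c. \<phi> (A a b c) = \<psi> (B a b c)"
  shows "\<phi> (series_mult s K A a b c) = \<psi> (series_mult s' K B a b c)"
proof -
  have "\<phi> (series_mult s K A a b c) =
      Sum_any (\<lambda>p. \<phi> (case p of (i, j, k) \<Rightarrow> s (K i j k) (A (a - i) (b - j) (c - k))))"
    unfolding series_mult_def
    by (rule linear_Sum_any[OF \<phi>]) (use assms(3) in \<open>simp add: case_prod_unfold\<close>)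
  also have "\<dots> = Sum_any (\<lambda>p. \<psi> (case p of (i, j, k) \<Rightarrow> s' (K i j k) (B (a - i) (b - j) (c - k))))"
    by (simp add: split_def linearD(2)[OF \<phi>] linearD(2)[OF \<psi>] eq)
  also have "\<dots> = \<psi> (series_mult s' K B a b c)"
    unfolding series_mult_def
    by (rule linear_Sum_any[OF \<psi>, symmetric]) (use assms(4) in \<open>simp add: case_prod_unfold\<close>)
  finally show ?thesis .
qed

lemma series_mult_mem:
  assumes s: "vector_space s" and S: "module.subspace s S" and A: "\<And>a b c. A a b c \<in> S"
  shows "series_mult s K A a b c \<in> S"
proof -
  interpret T: vector_space s by fact
  show ?thesis unfolding series_mult_def Sum_any.expand_set
    by (intro T.subspace_sum[OF S]) (auto intro!: T.subspace_scale[OF S] A)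
qed

end


section \<open>The coalgebra axioms\<close>

context voa_with_form
begin

lemma lower_truncation: "\<exists>M. \<forall>q < - M. Y v q w = 0"
proof -
  obtain N where N: "\<forall>k>N. Y v (- k - 1) w = 0" using truncation by blast
  have "Y v q w = 0" if "q < - (N + 1)" for q
    using N[rule_format, of "- q - 1"] that by simp
  then show ?thesis by blast
qed

context
  fixes Ups
  assumes adj: "adjoint_coproduct \<beta> Y Ups"
begin

lemma coproduct_mem: "Ups n u \<in> tensor2"
  and coproduct_form2: "Ups n u (form2 v w) = \<beta> u (Y v n w)"
  using adj unfolding adjoint_coproduct_iff by auto

lemma coproduct_linear: "Vector_Spaces.linear scale fun_scale (Ups n)"
proof (rule linearI[OF vector_space_fun_scale])
  interpret T: vector_space "fun_scale :: 'a \<Rightarrow> (('v \<Rightarrow> 'v \<Rightarrow> 'a) \<Rightarrow> 'a) \<Rightarrow> _"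
    by (rule vector_space_fun_scale)
  note [simp] = coproduct_mem coproduct_form2 form_simps
    T.subspace_add[OF subspace_tensor2]
  show "Ups n (x + y) = Ups n x + Ups n y" for x y
    by (rule tensor2_eqI) simp_all
  show "Ups n (r *s x) = fun_scale r (Ups n x)" for r x
    by (rule tensor2_eqI) (simp_all add: T.subspace_scale[OF subspace_tensor2], simp add: fun_scale_def)
qed

text \<open>
  Contracting the coproduct with \<open>\<omega>\<close> gives the adjoint of \<open>L(- k)\<close>, which is \<open>L(k)\<close> because the form
  preserves the Virasoro operators. The Virasoro relations, the grading and the derivative property are
  thereby inherited from the algebra.
\<close>
lemma covirasoro_mode_eq: "covirasoro_mode Ups (\<lambda>v. \<beta> v \<omega>) k = virasoro_mode Y \<omega> k"
proof
  fix v
  show "covirasoro_mode Ups (\<lambda>v. \<beta> v \<omega>) k v = virasoro_mode Y \<omega> k v"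
  proof (rule form_eqI_left)
    fix w
    have "\<beta> (virasoro_mode Y \<omega> k v) w = \<beta> v (virasoro_mode Y \<omega> (- k) w)"
      using preserving unfolding virasoro_preserving_def by blast
    then show "\<beta> (covirasoro_mode Ups (\<lambda>v. \<beta> v \<omega>) k v) w = \<beta> (virasoro_mode Y \<omega> k v) w"
      by (simp add: covirasoro_mode_def form_functional_id coproduct_mem coproduct_form2 virasoro_mode_def)
  qed
qed

lemma coproduct_vanishes: "\<exists>M. \<forall>n>M. Ups n u = 0"
proof -
  obtain M where M: "\<forall>n>M. \<forall>v w. \<beta> u (Y v n w) = 0" using matrix_coefficient_truncation by blast
  then have "Ups n u = 0" if "n > M" for n
    using that by (intro tensor2_eq_zero) (simp_all add: coproduct_mem coproduct_form2)
  then show ?thesis by blast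
qed

lemma map_id_coproduct_form3:
  "map_id_tensor (Ups m) (Ups n u) (form3 v1 v2 v3) = \<beta> u (Y v1 n (Y v2 m v3))"
proof -
  have "Ups m b (\<lambda>p q. form3 v1 v2 v3 a p q) = form2 v1 (Y v2 m v3) a b" for a b
  proof -
    have "(\<lambda>p q. form3 v1 v2 v3 a p q) = (\<lambda>p q. \<beta> a v1 * form2 v2 v3 p q)"
      by (simp add: form3_def form2_def mult.assoc)
    then show ?thesis
      using tensor2_scale_arg[OF coproduct_mem bilinear_map_form2] by (simp add: coproduct_form2) (simp add: form2_def)
  qed
  then show ?thesis
    unfolding map_id_tensor_apply[OF coproduct_linear coproduct_mem coproduct_mem trilinear_map_form3]
    by (simp add: coproduct_form2)
qed

lemma swap_map_id_coproduct_form3: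
  "swap_tensor_id (map_id_tensor (Ups m) (Ups n u)) (form3 v1 v2 v3) = \<beta> u (Y v2 n (Y v1 m v3))"
proof -
  have "(\<lambda>a b c. form3 v1 v2 v3 b a c) = form3 v2 v1 v3" by (simp add: form3_def fun_eq_iff)
  then show ?thesis
    unfolding swap_tensor_id_apply[OF map_id_tensor_mem[OF coproduct_linear coproduct_mem coproduct_mem] trilinear_map_form3]
    by (simp add: map_id_coproduct_form3)
qed

lemma map_coproduct_id_form3:
  "map_tensor_id (Ups m) (Ups n u) (form3 v1 v2 v3) = \<beta> u (Y (Y v1 m v2) n v3)"
proof -
  have "Ups m a (\<lambda>p q. form3 v1 v2 v3 p q b) = form2 (Y v1 m v2) v3 a b" for a b
  proof -
    have "(\<lambda>p q. form3 v1 v2 v3 p q b) = (\<lambda>p q. \<beta> b v3 * form2 v1 v2 p q)"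
      by (simp add: form3_def form2_def mult_ac)
    then show ?thesis
      using tensor2_scale_arg[OF coproduct_mem bilinear_map_form2]
      by (simp add: coproduct_form2) (simp add: form2_def mult.commute)
  qed
  then show ?thesis
    unfolding map_tensor_id_apply[OF coproduct_linear coproduct_mem coproduct_mem trilinear_map_form3]
    by (simp add: coproduct_form2)
qed

text \<open>
  Paired with \<open>v1 \<otimes> v2 \<otimes> v3\<close>, the three terms are the matrix coefficients against \<open>u\<close> of the three
  terms of the Jacobi identity for \<open>v1\<close>, \<open>v2\<close> applied to \<open>v3\<close>. Such pairings separate tensors.
\<close>
lemma coproduct_jacobi:
  "series_mult fun_scale (\<lambda>a b c. delta_quotient 1 a b c)
     (\<lambda>a b c. if a = 0 then map_id_tensor (Ups c) (Ups b u) else 0) a0 a1 a2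
   - series_mult fun_scale (\<lambda>a b c. delta_quotient (- 1) a c b)
     (\<lambda>a b c. if a = 0 then swap_tensor_id (map_id_tensor (Ups b) (Ups c u)) else 0) a0 a1 a2
   = series_mult fun_scale (\<lambda>a b c. delta_quotient 1 c b a)
     (\<lambda>a b c. if b = 0 then map_tensor_id (Ups a) (Ups c u) else 0) a0 a1 a2"
  (is "?T1 - ?T2 = ?T3")
proof -
  interpret T: vector_space "fun_scale :: 'a \<Rightarrow> (('v \<Rightarrow> 'v \<Rightarrow> 'v \<Rightarrow> 'a) \<Rightarrow> 'a) \<Rightarrow> _"
    by (rule vector_space_fun_scale)
  interpret T2: vector_space "fun_scale :: 'a \<Rightarrow> (('v \<Rightarrow> 'v \<Rightarrow> 'a) \<Rightarrow> 'a) \<Rightarrow> _"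
    by (rule vector_space_fun_scale)
  note mem = T.subspace_0[OF subspace_tensor3]
    map_id_tensor_mem[OF coproduct_linear coproduct_mem coproduct_mem]
    map_tensor_id_mem[OF coproduct_linear coproduct_mem coproduct_mem]
  have T: "?T1 \<in> tensor3" "?T2 \<in> tensor3" "?T3 \<in> tensor3"
    by (auto intro!: series_mult_mem[OF vector_space_fun_scale subspace_tensor3] mem swap_tensor_id_mem)
  obtain M where M: "\<And>n. n > M \<Longrightarrow> Ups n u = 0" using coproduct_vanishes by blast
  have lift0: "map_id_tensor (Ups m) 0 = 0" "map_tensor_id (Ups m) 0 = 0" "swap_tensor_id 0 = 0" for m
    by (rule tensor3_eqI; simp add: mem T2.subspace_0[OF subspace_tensor2] swap_tensor_id_mem trilinear_map_form3
        map_id_tensor_mem map_tensor_id_mem coproduct_linear coproduct_mem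
        map_id_tensor_apply map_tensor_id_apply swap_tensor_id_apply)+
  have far: "\<exists>M. \<forall>p q. M < p \<longrightarrow> q < - M \<longrightarrow> map_id_tensor (Ups q) (Ups p u) = 0"
    "\<exists>M. \<forall>p q. M < p \<longrightarrow> q < - M \<longrightarrow> swap_tensor_id (map_id_tensor (Ups q) (Ups p u)) = 0"
    "\<exists>M. \<forall>p q. M < p \<longrightarrow> q < - M \<longrightarrow> map_tensor_id (Ups q) (Ups p u) = 0"
    by (rule exI[of _ M]; simp add: M lift0)+
  show ?thesis
  proof (rule tensor3_eqI)
    fix v1 v2 v3
    have far_Y: "\<exists>M. \<forall>p q. M < p \<longrightarrow> q < - M \<longrightarrow> Y v1 p (Y v2 q v3) = 0"
      "\<exists>M. \<forall>p q. M < p \<longrightarrow> q < - M \<longrightarrow> Y v2 p (Y v1 q v3) = 0"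
      "\<exists>M. \<forall>p q. M < p \<longrightarrow> q < - M \<longrightarrow> Y (Y v1 q v2) p v3 = 0"
      using lower_truncation[of v2 v3] lower_truncation[of v1 v3] lower_truncation[of v1 v2]
      by (metis bilinear_map_zero[OF Y_bilinear])+
    note pair = series_mult_compare[OF linear_eval bilinear_map_linear(1)[OF bilinear_form]]
    have 1: "?T1 (form3 v1 v2 v3) = \<beta> u (series_mult scale (\<lambda>a b c. delta_quotient 1 a b c)
         (\<lambda>a b c. if a = 0 then Y v1 b (Y v2 c v3) else 0) a0 a1 a2)"
      by (rule pair[OF finite_delta_supports(1)[OF vector_space_fun_scale far(1)]
            finite_delta_supports(1)[OF vector_space_axioms far_Y(1)]])
        (simp add: map_id_coproduct_form3 form_simps)
    have 2: "?T2 (form3 v1 v2 v3) = \<beta> u (series_mult scale (\<lambda>a b c. delta_quotient (- 1) a c b)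
         (\<lambda>a b c. if a = 0 then Y v2 c (Y v1 b v3) else 0) a0 a1 a2)"
      by (rule pair[OF finite_delta_supports(2)[OF vector_space_fun_scale far(2)]
            finite_delta_supports(2)[OF vector_space_axioms far_Y(2)]])
        (simp add: swap_map_id_coproduct_form3 form_simps)
    have 3: "?T3 (form3 v1 v2 v3) = \<beta> u (series_mult scale (\<lambda>a b c. delta_quotient 1 c b a)
         (\<lambda>a b c. if b = 0 then Y (Y v1 a v2) c v3 else 0) a0 a1 a2)"
      by (rule pair[OF finite_delta_supports(3)[OF vector_space_fun_scale far(3)]
            finite_delta_supports(3)[OF vector_space_axioms far_Y(3)]])
        (simp add: map_coproduct_id_form3 form_simps)
    show "(?T1 - ?T2) (form3 v1 v2 v3) = ?T3 (form3 v1 v2 v3)"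
      unfolding fun_diff_def 1 2 3 bilinear_map_diff(2)[OF bilinear_form, symmetric] jacobi by (rule refl)
  qed (use T in \<open>auto intro: T.subspace_diff[OF subspace_tensor3]\<close>)
qed

lemma coproduct_derivative:
  "fun_scale (of_int (n + 1)) (Ups (n + 1) v) = operator_id (virasoro_mode Y \<omega> 1) (Ups n v)"
proof (rule tensor2_eqI)
  interpret T: vector_space "fun_scale :: 'a \<Rightarrow> (('v \<Rightarrow> 'v \<Rightarrow> 'a) \<Rightarrow> 'a) \<Rightarrow> _"
    by (rule vector_space_fun_scale)
  show "fun_scale (of_int (n + 1)) (Ups (n + 1) v) \<in> tensor2"
    by (rule T.subspace_scale[OF subspace_tensor2 coproduct_mem])
  show "operator_id (virasoro_mode Y \<omega> 1) (Ups n v) \<in> tensor2"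
    by (rule operator_id_mem[OF virasoro_mode_linear coproduct_mem])
  fix x y
  have "(\<lambda>a b. form2 x y (virasoro_mode Y \<omega> 1 a) b) = form2 (virasoro_mode Y \<omega> (- 1) x) y"
    using preserving unfolding virasoro_preserving_def form2_def by simp
  then have "operator_id (virasoro_mode Y \<omega> 1) (Ups n v) (form2 x y) =
      \<beta> v (Y (virasoro_mode Y \<omega> (- 1) x) n y)"
    unfolding operator_id_apply[OF virasoro_mode_linear coproduct_mem bilinear_map_form2]
    by (simp add: coproduct_form2)
  also have "\<dots> = \<beta> v (of_int (n + 1) *s Y x (n + 1) y)" by (simp only: derivative)
  finally show "fun_scale (of_int (n + 1)) (Ups (n + 1) v) (form2 x y) =
      operator_id (virasoro_mode Y \<omega> 1) (Ups n v) (form2 x y)"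
    by (simp add: fun_scale_def coproduct_form2 form_simps)
qed

theorem adjoint_coproduct_coalgebra:
  "vertex_operator_coalgebra scale G Ups (\<lambda>v. \<beta> v vac) (\<lambda>v. \<beta> v \<omega>) d"
proof (intro vertex_operator_coalgebra.intro vertex_operator_coalgebra_axioms.intro)
  show "graded_vector_space scale G" by (rule graded_vector_space_axioms)
  show "Ups n v \<in> tensor2" for n v by (rule coproduct_mem)
  show "Vector_Spaces.linear scale fun_scale (Ups n)" for n by (rule coproduct_linear)
  show "Vector_Spaces.linear scale (*) (\<lambda>v. \<beta> v vac)" "Vector_Spaces.linear scale (*) (\<lambda>v. \<beta> v \<omega>)"
    by (rule bilinear_map_linear(2)[OF bilinear_form])+
  show "functional_id (\<lambda>v. \<beta> v vac) (Ups n v) = (if n = 0 then v else 0)" for n v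
    by (rule form_eqI_left)
      (simp add: form_functional_id coproduct_mem coproduct_form2 left_unit form_simps)
  show "id_functional (\<lambda>v. \<beta> v vac) (Ups n v) = 0" if "n < 0" for n v
    by (rule form_eqI_left)
      (simp add: form_id_functional coproduct_mem coproduct_form2 creation_regular that form_simps)
  show "id_functional (\<lambda>v. \<beta> v vac) (Ups 0 v) = v" for v
    by (rule form_eqI_left)
      (simp add: form_id_functional coproduct_mem coproduct_form2 creation_limit)
  show "\<exists>N. \<forall>k<N. Ups (- k - 1) v = 0" for v
  proof -
    obtain M where M: "\<forall>n>M. Ups n v = 0" using coproduct_vanishes by blast
    show ?thesis by (rule exI[of _ "- M - 1"]) (simp add: M)
  qed
  show "virasoro_relations (covirasoro_mode Ups (\<lambda>v. \<beta> v \<omega>)) d"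
    unfolding covirasoro_mode_eq[abs_def] using virasoro .
  show "covirasoro_mode Ups (\<lambda>v. \<beta> v \<omega>) 0 v = of_int k *s v" if "v \<in> G k" for k v
    unfolding covirasoro_mode_eq using that by (rule grading)
  show "fun_scale (of_int (n + 1)) (Ups (n + 1) v) = operator_id (covirasoro_mode Ups (\<lambda>v. \<beta> v \<omega>) 1) (Ups n v)" for n v
    unfolding covirasoro_mode_eq by (rule coproduct_derivative)
qed (rule coproduct_jacobi)

end

end


section \<open>Vertex operator coalgebras from vertex operator algebras\<close>

theorem theorem3p1:
  fixes scale :: "'a::field \<Rightarrow> 'v::ab_group_add \<Rightarrow> 'v"
    and G :: "int \<Rightarrow> 'v set"
    and Y :: "'v \<Rightarrow> int \<Rightarrow> 'v \<Rightarrow> 'v"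
    and vac \<omega> :: 'v
    and d :: 'a
    and \<beta> :: "'v \<Rightarrow> 'v \<Rightarrow> 'a"
  assumes "vertex_operator_algebra scale G Y vac \<omega> d"
    and "linear_space.bilinear_map scale (*) \<beta>"
    and "nondegenerate \<beta>"
    and "virasoro_preserving Y \<omega> \<beta>"
    and "CHAR('a) = 0 \<or> weight_compatible G Y \<beta>"
  shows "(\<exists>!Ups. linear_space.adjoint_coproduct scale \<beta> Y Ups) \<and>
    (\<forall>Ups. linear_space.adjoint_coproduct scale \<beta> Y Ups \<longrightarrow>
      vertex_operator_coalgebra scale G Ups (\<lambda>v. \<beta> v vac) (\<lambda>v. \<beta> v \<omega>) d)"
proof -
  interpret vertex_operator_algebra scale G Y vac \<omega> d by (fact assms(1))
  have "weight_compatible G Y \<beta>"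
    using assms(5) weight_compatible_char_0[OF _ assms(2,4)] by blast
  then interpret voa_with_form scale G Y vac \<omega> d \<beta>
    using assms(2,3,4) by unfold_locales
  show ?thesis
    using adjoint_coproduct_unique_existence adjoint_coproduct_coalgebra by blast
qed

end
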